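(* For any pair of integers $n\geq 4$ and $2\leq k\leq n-2$, there is a tropical variety of dimension $k$ in $\mathbb{R}^n$ whose complement is not globally $(n-k)$-convex.
   Context: **Tropical varieties.** A polyhedron in $\mathbb{R}^n$ is rational if it is a finite intersection of closed half-spaces whose normal vectors are rational; its directions are then spanned by integer vectors. For a rational polyhedron $\sigma$, let $\mathrm{Aff}(\sigma)$ be its affine span and $H_\sigma$ the linear subspace obtained by translating $\mathrm{Aff}(\sigma)$ to the origin. If $\tau$ is a codimension one face of a $p$-dimensional rational polyhedron $\sigma$, let $u_{\sigma/\tau}$ be the unique generator of the rank one lattice $(H_\sigma\cap\mathbb{Z}^n)/(H_\tau\cap\mathbb{Z}^n)$ that points from $\tau$ in the direction of $\sigma$. A $p$-dimensional weighted complex $\mathcal{C}$ is a rational polyhedral complex in $\mathbb{R}^n$, all of whose inclusion-maximal cells have dimension $p$, together with a real weight $w_{\mathcal{C}}(\sigma)$ for each $p$-dimensional cell $\sigma$. It is balanced if for every $(p-1)$-dimensional cell $\tau$ one has $\sum_{\sigma\supset\tau} w_{\mathcal{C}}(\sigma)\,u_{\sigma/\tau}=0$ in $\mathbb{Z}^n/(H_\tau\cap\mathbb{Z}^n)$ (tensored with $\mathbb{R}$ if weights are not integers), the sum being over all $p$-dimensional cells $\sigma$ of $\mathcal{C}$ containing $\tau$ as a face. A tropical variety of dimension $p$ is a balanced $p$-dimensional weighted complex with finitely many cells and with all weights positive. Its complement is the complement in $\mathbb{R}^n$ of the union of its cells. **Global convexity.** A subset $X\subseteq\mathbb{R}^n$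 is globally $m$-convex if for every affine $m$-plane $L\subseteq\mathbb{R}^n$ the homomorphism of reduced (singular) homology groups $\widetilde{H}_{m-1}(L\cap X)\to\widetilde{H}_{m-1}(X)$ induced by inclusion is injective. *)

theory Defs
  imports "HOL-Analysis.Analysis" "HOL-Homology.Homology"
begin

section \<open>Rational polyhedra and lattices\<close>

text \<open>Only the normal vectors are rational; the offsets \<open>b\<close> may be arbitrary reals.\<close>

definition rational_polyhedron :: "(real^'n) set \<Rightarrow> bool" where
  "rational_polyhedron S \<longleftrightarrow>
     (\<exists>F. finite F \<and> S = \<Inter>F \<and>
        (\<forall>h\<in>F. \<exists>a b. a \<noteq> 0 \<and> (\<forall>i. a $ i \<in> \<rat>) \<and> h = {x. a \<bullet> x \<le> b}))"

definition integer_lattice :: "(real^'n) set" where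
  "integer_lattice = {x. \<forall>i. x $ i \<in> \<int>}"

text \<open>The affine span translated to the origin, written as the set of its differences.\<close>

definition direction_space :: "(real^'n) set \<Rightarrow> (real^'n) set" where
  "direction_space S = {x - y | x y. x \<in> affine hull S \<and> y \<in> affine hull S}"

definition direction_lattice :: "(real^'n) set \<Rightarrow> (real^'n) set" where
  "direction_lattice S = direction_space S \<inter> integer_lattice"

text \<open>
  \<open>lattice_normal \<sigma> \<tau> u\<close> says that \<open>u\<close> is a representative of the generator of the rank one
  lattice \<open>direction_lattice \<sigma> / direction_lattice \<tau>\<close> that points from the facet \<open>\<tau>\<close> in the
  direction of \<open>\<sigma>\<close>. The generator itself is a coset; by \<open>lattice_normal_unique\<close> below, all
  representatives lie in one coset of \<open>direction_lattice \<tau>\<close>.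
  The base point \<open>x\<close> is existentially quantified because the points of \<open>\<tau>\<close> from which one can
  move inside \<open>\<sigma>\<close> along \<open>u\<close> depend on the chosen representative.
\<close>

definition lattice_normal :: "(real^'n) set \<Rightarrow> (real^'n) set \<Rightarrow> real^'n \<Rightarrow> bool" where
  "lattice_normal \<sigma> \<tau> u \<longleftrightarrow>
     u \<in> direction_lattice \<sigma> \<and>
     direction_lattice \<sigma> = {v + of_int j *\<^sub>R u | v j. v \<in> direction_lattice \<tau>} \<and>
     (\<exists>x\<in>\<tau>. \<exists>\<epsilon>>0. x + \<epsilon> *\<^sub>R u \<in> \<sigma>)"

section \<open>Tropical varieties\<close>

text \<open>Cells are nonempty, so a face or an intersection of cells is a cell unless it is empty
  (\<open>{} face_of S\<close> always holds).\<close>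

definition rational_polyhedral_complex :: "(real^'n) set set \<Rightarrow> bool" where
  "rational_polyhedral_complex C \<longleftrightarrow>
     (\<forall>\<sigma>\<in>C. rational_polyhedron \<sigma> \<and> \<sigma> \<noteq> {}) \<and>
     (\<forall>\<sigma>\<in>C. \<forall>\<tau>. \<tau> face_of \<sigma> \<and> \<tau> \<noteq> {} \<longrightarrow> \<tau> \<in> C) \<and>
     (\<forall>\<sigma>\<in>C. \<forall>\<sigma>'\<in>C. (\<sigma> \<inter> \<sigma>') face_of \<sigma> \<and> (\<sigma> \<inter> \<sigma>') face_of \<sigma>')"

text \<open>A weighted complex is such a \<open>C\<close> together with a function \<open>w\<close>, of which only the values on
  the \<open>p\<close>-dimensional cells matter.\<close>

definition pure_dimensional :: "nat \<Rightarrow> (real^'n) set set \<Rightarrow> bool" where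
  "pure_dimensional p C \<longleftrightarrow>
     (\<forall>\<sigma>\<in>C. (\<forall>\<sigma>'\<in>C. \<sigma> \<subseteq> \<sigma>' \<longrightarrow> \<sigma>' = \<sigma>) \<longrightarrow> aff_dim \<sigma> = int p)"

text \<open>
  The weights are real, so the balancing sum is taken in the quotient of the integer lattice by
  \<open>direction_lattice \<tau>\<close> tensored with the reals, which is \<open>real^'n\<close> modulo
  \<open>span (direction_lattice \<tau>)\<close>. By \<open>lattice_normal_unique\<close> it does not matter which
  representatives \<open>u\<close> are chosen. The sum has its intended meaning only if finitely many cells
  contain \<open>\<tau>\<close>, which \<open>tropical_variety\<close> guarantees.
\<close>

definition balanced :: "nat \<Rightarrow> (real^'n) set set \<Rightarrow> ((real^'n) set \<Rightarrow> real) \<Rightarrow> bool" where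
  "balanced p C w \<longleftrightarrow>
     (\<forall>\<tau>\<in>C. aff_dim \<tau> = int p - 1 \<longrightarrow>
        (\<exists>u. (\<forall>\<sigma>\<in>C. aff_dim \<sigma> = int p \<and> \<tau> face_of \<sigma> \<longrightarrow> lattice_normal \<sigma> \<tau> (u \<sigma>)) \<and>
             (\<Sum>\<sigma> | \<sigma> \<in> C \<and> aff_dim \<sigma> = int p \<and> \<tau> face_of \<sigma>. w \<sigma> *\<^sub>R u \<sigma>)
               \<in> span (direction_lattice \<tau>)))"

definition tropical_variety :: "nat \<Rightarrow> (real^'n) set set \<Rightarrow> ((real^'n) set \<Rightarrow> real) \<Rightarrow> bool" where
  "tropical_variety p C w \<longleftrightarrow>
     finite C \<and> rational_polyhedral_complex C \<and> pure_dimensional p C \<and> balanced p C w \<and>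
     (\<forall>\<sigma>\<in>C. aff_dim \<sigma> = int p \<longrightarrow> w \<sigma> > 0)"

section \<open>Global convexity\<close>

definition globally_convex :: "nat \<Rightarrow> (real^'n) set \<Rightarrow> bool" where
  "globally_convex m X \<longleftrightarrow>
     (\<forall>L. affine L \<and> aff_dim L = int m \<longrightarrow>
        inj_on (hom_induced (int m - 1) (top_of_set (L \<inter> X)) {} (top_of_set X) {} id)
               (carrier (reduced_homology_group (int m - 1) (top_of_set (L \<inter> X)))))"

section \<open>Uniqueness of the lattice normal modulo the lattice of the facet\<close>

lemma subspace_direction_space:
  assumes "S \<noteq> {}"
  shows "subspace (direction_space S)"
proof -
  obtain a where a: "a \<in> affine hull S" using assms hull_inc by fastforce
  have "direction_space S = {x - y | x y. x \<in> affine hull S \<and> y \<in> affine hull S}"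
    by (simp add: direction_space_def)
  also have "\<dots> = {x - a | x. x \<in> affine hull S}"
  proof safe
    fix x y assume xy: "x \<in> affine hull S" "y \<in> affine hull S"
    have "a + 1 *\<^sub>R (x - y) \<in> affine hull S"
      by (rule mem_affine_3_minus[OF affine_affine_hull a xy])
    then show "\<exists>x'. x - y = x' - a \<and> x' \<in> affine hull S"
      by (intro exI[of _ "a + (x - y)"]) simp
  qed (use a in auto)
  also have "\<dots> = (\<lambda>x. (- a) + x) ` (affine hull S)" by auto
  also have "subspace \<dots>"
    using affine_diffs_subspace[OF affine_affine_hull a] by simp
  finally show ?thesis .
qed

lemma affine_hull_add_direction:
  assumes "x \<in> affine hull S" "v \<in> direction_space S"
  shows "x + v \<in> affine hull S"
proof -
  obtain y z where v: "v = y - z" "y \<in> affine hull S" "z \<in> affine hull S"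
    using assms(2) by (auto simp: direction_space_def)
  show ?thesis
    using mem_affine_3_minus[OF affine_affine_hull assms(1) v(2,3), of 1] v(1) by simp
qed

lemma integer_lattice_diff:
  "x \<in> integer_lattice \<Longrightarrow> y \<in> integer_lattice \<Longrightarrow> x - y \<in> integer_lattice"
  by (auto simp: integer_lattice_def)

lemma lattice_normal_unique:
  assumes face: "\<tau> face_of \<sigma>" and conv: "convex \<sigma>"
    and u: "lattice_normal \<sigma> \<tau> u" and u': "lattice_normal \<sigma> \<tau> u'"
  shows "u' - u \<in> direction_lattice \<tau>"
proof -
  let ?H = "direction_space \<tau>"
  obtain x e where x: "x \<in> \<tau>" "e > 0" "x + e *\<^sub>R u \<in> \<sigma>"
    using u by (auto simp: lattice_normal_def)
  obtain x' e' where x': "x' \<in> \<tau>" "e' > 0" "x' + e' *\<^sub>R u' \<in> \<sigma>"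
    using u' by (auto simp: lattice_normal_def)
  have sub: "subspace ?H" using x(1) by (intro subspace_direction_space) auto
  have int: "u \<in> integer_lattice" "u' \<in> integer_lattice"
    using u u' unfolding lattice_normal_def direction_lattice_def by blast+
  have "u' \<in> {v + of_int j *\<^sub>R u | v j. v \<in> direction_lattice \<tau>}"
    using u u' unfolding lattice_normal_def by blast
  then obtain v j where v: "u' = v + of_int j *\<^sub>R u" "v \<in> ?H"
    by (auto simp: direction_lattice_def)
  have "u \<in> {v + of_int j *\<^sub>R u' | v j. v \<in> direction_lattice \<tau>}"
    using u u' unfolding lattice_normal_def by blast
  then obtain v' j' where v': "u = v' + of_int j' *\<^sub>R u'" "v' \<in> ?H"
    by (auto simp: direction_lattice_def)
  have *: "u' \<in> ?H" if "u \<in> ?H"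
    unfolding v(1) using sub v(2) that by (intro subspace_add subspace_scale)
  have "u' - u \<in> ?H"
  proof (cases "u \<in> ?H")
    case True
    then show ?thesis using * sub by (intro subspace_diff)
  next
    case False
    have eq: "(1 - of_int (j' * j)) *\<^sub>R u = v' + of_int j' *\<^sub>R v"
      using v'(1) unfolding v(1) by (simp add: algebra_simps)
    have mem: "(1 - real_of_int (j' * j)) *\<^sub>R u \<in> ?H"
      unfolding eq using sub v(2) v'(2) by (intro subspace_add subspace_scale)
    have "j' * j = 1"
    proof (rule ccontr)
      assume "j' * j \<noteq> 1"
      then have c: "1 - real_of_int (j' * j) \<noteq> 0"
        by (metis eq_iff_diff_eq_0 of_int_1 of_int_eq_iff)
      have "inverse (1 - real_of_int (j' * j)) *\<^sub>R (1 - real_of_int (j' * j)) *\<^sub>R u \<in> ?H"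
        by (rule subspace_scale[OF sub mem])
      with c False show False by simp
    qed
    then consider "j = 1" | "j = -1" by (metis zmult_eq_1_iff)
    then show ?thesis
    proof cases
      case 1
      then show ?thesis using v by simp
    next
      case 2
      define a where "a = x + e *\<^sub>R u"
      define b where "b = x' + e' *\<^sub>R u'"
      define t where "t = e / (e + e')"
      define z where "z = (1 - t) *\<^sub>R a + t *\<^sub>R b"
      have t: "0 < t" "t < 1" "(1 - t) * e = t * e'"
        using x(2) x'(2) by (auto simp: t_def field_simps)
      have z_eq: "z = ((1 - t) *\<^sub>R x + t *\<^sub>R x') + (t * e') *\<^sub>R v"
      proof -
        have "z = (1 - t) *\<^sub>R x + t *\<^sub>R x' + ((1 - t) * e) *\<^sub>R u + (t * e') *\<^sub>R u'"
          by (simp add: z_def a_def b_def scaleR_add_right)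
        also have "\<dots> = ((1 - t) *\<^sub>R x + t *\<^sub>R x') + (t * e') *\<^sub>R v"
          unfolding t(3) v(1) 2 by (simp add: scaleR_add_right scaleR_diff_right)
        finally show ?thesis .
      qed
      have "(1 - t) *\<^sub>R x + t *\<^sub>R x' \<in> affine hull \<tau>"
        using x(1) x'(1) by (intro mem_affine[OF affine_affine_hull]) (auto simp: hull_inc)
      then have "z \<in> affine hull \<tau>"
        unfolding z_eq using subspace_scale[OF sub v(2)] by (rule affine_hull_add_direction)
      moreover have "z \<in> \<sigma>"
        unfolding z_def using conv x(3) x'(3) t a_def b_def by (intro convexD) auto
      ultimately have z: "z \<in> \<tau>"
        using face_of_imp_eq_affine_Int[OF conv face] by blast
      have "a \<in> \<tau>"
      proof (cases "a = b")
        case True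
        then show ?thesis using z by (simp add: z_def flip: scaleR_add_left)
      next
        case False
        then have "z \<in> open_segment a b" using t by (auto simp: in_segment z_def)
        then show ?thesis using face_ofD[OF face _ _ _ z] x(3) x'(3) a_def b_def by blast
      qed
      then have "a \<in> affine hull \<tau>" "x \<in> affine hull \<tau>"
        using x(1) by (auto intro: hull_inc)
      then have "a - x \<in> ?H"
        unfolding direction_space_def by blast
      then have "inverse e *\<^sub>R (a - x) \<in> ?H" by (rule subspace_scale[OF sub])
      then show ?thesis using False x(2) by (simp add: a_def)
    qed
  qed
  then show ?thesis using int by (simp add: direction_lattice_def integer_lattice_diff)
qed

end

theory Submission
  imports Defs
begin

text \<open>
  Split the space as base times fibre, of dimensions \<open>k\<close> and \<open>n - k\<close>. Let \<open>l\<^sub>0, l\<^sub>1, l\<^sub>2\<close> be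
  pairwise independent linear forms on the base with sum \<open>0\<close>, and \<open>c\<^sub>0, c\<^sub>1, c\<^sub>2\<close> pairwise
  independent fibre vectors. The variety consists of the half-spaces \<open>(x, \<plusminus> l\<^sub>i(x) c\<^sub>i)\<close>,
  \<open>l\<^sub>i(x) \<ge> 0\<close>, with weight 1, and of the flat sectors \<open>(x, 0)\<close>, where at most one \<open>l\<^sub>i(x)\<close> is
  positive, with weight 2. Crossing \<open>l\<^sub>i = 0\<close> trades one flat sheet for two half-spaces, and
  \<open>(d, c\<^sub>i) + (d, - c\<^sub>i) = 2 (d, 0)\<close> is the balancing condition.

  Over a point where only \<open>l\<^sub>j\<close> is positive the fibre of the variety is \<open>{0, \<plusminus> l\<^sub>j c\<^sub>j}\<close>; let
  \<open>a\<^sub>j\<close> be the class in the complement of a small sphere around \<open>0\<close> in this fibre, and \<open>B\<close> that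
  of a sphere around all three points. When \<open>l\<^sub>i\<close> grows from negative to positive values,
  the sphere of \<open>a\<^sub>j\<close> can be stretched to an ellipsoid around \<open>\<plusminus> l\<^sub>i c\<^sub>i\<close> that leaves
  \<open>\<plusminus> l\<^sub>j c\<^sub>j\<close> outside, so \<open>a\<^sub>j + a\<^sub>i = B\<close> for \<open>i \<noteq> j\<close>. Hence \<open>2 a\<^sub>0 = B\<close> in the complement of
  the variety, but in the fibre where only \<open>l\<^sub>0\<close> is positive \<open>2 a\<^sub>0 - B\<close> has degree \<open>-1\<close> around
  \<open>l\<^sub>0 c\<^sub>0\<close>.
\<close>

section \<open>Spheres in a punctured vector space\<close>

lemma trivial_homology_group_convex:
  fixes W :: "'a::real_normed_vector set"
  assumes "convex W" "p \<noteq> 0"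
  shows "trivial_group (homology_group p (top_of_set W))"
proof -
  have "contractible_space (top_of_set W)"
    using assms(1) convex_imp_contractible contractible_space_top_of_set by blast
  then have "trivial_group (reduced_homology_group p (top_of_set W))"
    by (rule trivial_reduced_homology_group_contractible_space)
  then show ?thesis using un_reduced_homology_group[OF assms(2)] by metis
qed

text \<open>
  Filling in one puncture \<open>a\<close> kills the class by induction on \<open>F\<close>, so it is the boundary of a class
  relative to the complement of \<open>a\<close>; excision identifies that relative group with the one of
  \<open>(W, W - {a})\<close>, where the boundary map is injective.
\<close>

lemma homology_class_punctured_trivial:
  fixes W :: "'a::real_normed_vector set"
  assumes "finite F" and W: "convex W" and p: "p > 0"
    and "z \<in> carrier (homology_group p (top_of_set (W - F)))"
    and "\<And>q. q \<in> F \<Longrightarrow> hom_induced p (top_of_set (W - F)) {} (top_of_set (W - {q})) {} id z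
           = \<one>\<^bsub>homology_group p (top_of_set (W - {q}))\<^esub>"
  shows "z = \<one>\<^bsub>homology_group p (top_of_set (W - F))\<^esub>"
  using assms(1,4,5)
proof (induction F arbitrary: z rule: finite_induct)
  case empty
  then show ?case using trivial_homology_group_convex[OF W] p by (auto simp: trivial_group_def)
next
  case (insert a F)
  let ?X = "top_of_set W" and ?Y = "top_of_set (W - F)" and ?S = "- {a}"
  let ?Z = "top_of_set (W - insert a F)"
  have Z: "subtopology ?Y ?S = ?Z" "subtopology ?X ?S = top_of_set (W - {a})"
    by (auto simp: subtopology_subtopology intro!: arg_cong[where f = "top_of_set"])
  have cX: "continuous_map ?Y ?X id"
    by (auto intro!: continuous_on_id)
  have "hom_induced p ?Z {} ?Y {} id z = \<one>\<^bsub>homology_group p ?Y\<^esub>"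
  proof (rule insert.IH)
    fix q assume q: "q \<in> F"
    have "hom_induced p ?Y {} (top_of_set (W - {q})) {} id (hom_induced p ?Z {} ?Y {} id z)
        = hom_induced p ?Z {} (top_of_set (W - {q})) {} (id \<circ> id) z"
      using q by (intro hom_induced_compose') (auto intro!: continuous_on_id)
    then show "hom_induced p ?Y {} (top_of_set (W - {q})) {} id (hom_induced p ?Z {} ?Y {} id z)
        = \<one>\<^bsub>homology_group p (top_of_set (W - {q}))\<^esub>"
      using insert.prems(2)[of q] q by simp
  qed (simp add: hom_induced_carrier)
  then have "z \<in> kernel (homology_group p ?Z) (homology_group p ?Y) (hom_induced p ?Z {} ?Y {} id)"
    using insert.prems(1) by (simp add: kernel_def)
  then obtain \<zeta> where \<zeta>: "\<zeta> \<in> carrier (relative_homology_group (p+1) ?Y ?S)"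
      "z = hom_boundary (p+1) ?Y ?S \<zeta>"
    using homology_exactness_axiom_2[of "p+1" ?Y ?S] unfolding Z by auto
  let ?\<xi> = "hom_induced (p+1) ?Y ?S ?X ?S id \<zeta>"
  have "hom_boundary (p+1) ?X ?S ?\<xi> = hom_induced p ?Z {} (top_of_set (W - {a})) {} id z"
    using naturality_hom_induced[OF cX, of ?S ?S "p+1"] \<zeta>(2) unfolding Z by (simp add: fun_eq_iff)
  also have "\<dots> = \<one>\<^bsub>homology_group p (top_of_set (W - {a}))\<^esub>"
    by (rule insert.prems(2)) simp
  finally have "?\<xi> \<in> kernel (relative_homology_group (p+1) ?X ?S)
      (homology_group p (top_of_set (W - {a}))) (hom_boundary (p+1) ?X ?S)"
    by (simp add: kernel_def hom_induced_carrier)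
  then have "?\<xi> \<in> hom_induced (p+1) ?X {} ?X ?S id ` carrier (homology_group (p+1) ?X)"
    using homology_exactness_axiom_1[of "p+1" ?X ?S] unfolding Z by auto
  moreover have "carrier (homology_group (p+1) ?X) = {\<one>\<^bsub>homology_group (p+1) ?X\<^esub>}"
    using trivial_homology_group_convex[OF W, of "p+1"] p by (simp add: trivial_group_def)
  ultimately have \<xi>: "?\<xi> = \<one>\<^bsub>relative_homology_group (p+1) ?X ?S\<^esub>"
    using hom_one[OF hom_induced_hom[of "p+1" ?X "{}" ?X ?S id]] by simp
  have "hom_induced (p+1) (subtopology ?X (UNIV - F)) (?S - F) (subtopology ?X UNIV) ?S id
     \<in> iso (relative_homology_group (p+1) (subtopology ?X (UNIV - F)) (?S - F))
           (relative_homology_group (p+1) (subtopology ?X UNIV) ?S)"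
  proof (rule homology_excision_axiom)
    have "?X closure_of F \<subseteq> F"
      using insert.hyps(1) by (auto simp: closure_of_subtopology finite_imp_closed)
    moreover have "openin ?X (W \<inter> ?S)" by (intro openin_open_Int) auto
    then have "W \<inter> ?S \<subseteq> ?X interior_of ?S" by (intro interior_of_maximal) auto
    moreover have "?X closure_of F \<subseteq> W" by (metis closure_of_subset_topspace topspace_euclidean_subtopology)
    ultimately show "?X closure_of F \<subseteq> ?X interior_of ?S"
      using insert.hyps(2) by blast
  qed auto
  moreover have "subtopology ?X (UNIV - F) = ?Y" "subtopology ?X UNIV = ?X"
    by (auto simp: subtopology_subtopology intro!: arg_cong[where f = "top_of_set"])
  \<comment> \<open>A relative group and its induced maps depend only on the part of the second set
    inside the space, and \<open>?S - F\<close> and \<open>?S\<close> meet \<open>W - F\<close> in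
    the same points.\<close>
  moreover have eq: "topspace ?Y \<inter> (?S - F) = topspace ?Y \<inter> ?S" by auto
  moreover have "relative_homology_group (p+1) ?Y (?S - F) = relative_homology_group (p+1) ?Y ?S"
    using relative_homology_group_restrict[of "p+1" ?Y "?S - F"]
      relative_homology_group_restrict[of "p+1" ?Y ?S] eq by simp
  moreover have "hom_induced (p+1) ?Y (?S - F) ?X ?S id = hom_induced (p+1) ?Y ?S ?X ?S id"
    using hom_induced_restrict[of "p+1" ?Y "?S - F" ?X ?S]
      hom_induced_restrict[of "p+1" ?Y ?S ?X ?S] eq by simp
  ultimately have iso: "hom_induced (p+1) ?Y ?S ?X ?S id
     \<in> iso (relative_homology_group (p+1) ?Y ?S) (relative_homology_group (p+1) ?X ?S)"
    by simp
  have "\<zeta> = \<one>\<^bsub>relative_homology_group (p+1) ?Y ?S\<^esub>"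
  proof (rule inj_onD)
    show "inj_on (hom_induced (p+1) ?Y ?S ?X ?S id) (carrier (relative_homology_group (p+1) ?Y ?S))"
      using iso by (simp add: iso_iff)
    show "?\<xi> = hom_induced (p+1) ?Y ?S ?X ?S id \<one>\<^bsub>relative_homology_group (p+1) ?Y ?S\<^esub>"
      using \<xi> hom_one[OF hom_induced_hom[of "p+1" ?Y ?S ?X ?S id]] by simp
  qed (use \<zeta>(1) in \<open>simp_all add: group.is_monoid monoid.one_closed\<close>)
  then show ?case
    using \<zeta>(2) hom_one[OF hom_boundary_hom[of "p+1" ?Y ?S]] Z by simp
qed

section \<open>Induced maps: homotopies, constant maps, composites\<close>

lemma hom_induced_homotopy:
  assumes "continuous_on ({0..1} \<times> S) (\<lambda>(t,s). h t s)"
    and "\<And>t s. t \<in> {0..1} \<Longrightarrow> s \<in> S \<Longrightarrow> h t s \<in> X"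
  shows "hom_induced p (top_of_set S) {} (top_of_set X) {} (h 0)
       = hom_induced p (top_of_set S) {} (top_of_set X) {} (h (1::real))"
proof (rule homology_homotopy_empty)
  show "homotopic_with (\<lambda>h. True) (top_of_set S) (top_of_set X) (h 0) (h 1)"
    unfolding homotopic_with_def
    by (rule exI[of _ "\<lambda>(t,s). h t s"])
      (use assms in \<open>auto simp: prod_topology_subtopology_eu continuous_map_subtopology_eu\<close>)
qed

text \<open>A constant map factors through a space with at most one point, whose homology vanishes
  in nonzero degrees.\<close>

lemma hom_induced_const:
  assumes p: "p \<noteq> 0"
  shows "hom_induced p X {} Y {} (\<lambda>x. y) z = \<one>\<^bsub>homology_group p Y\<^esub>"
proof (cases "continuous_map X Y (\<lambda>x. y) \<and> z \<in> carrier (homology_group p X)")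
  \<comment> \<open>For a discontinuous map, or outside the carrier, the default value of
    \<open>hom_induced\<close> is the neutral element.\<close>
  case False
  then show ?thesis by (intro hom_induced_default) auto
next
  case True
  let ?Z = "subtopology Y {y}"
  have "continuous_map X ?Z (\<lambda>x. y)" "continuous_map ?Z Y id"
    using True by (auto simp: continuous_map_in_subtopology continuous_map_from_subtopology)
  then have *: "hom_induced p X {} Y {} (\<lambda>x. y) z
      = hom_induced p ?Z {} Y {} id (hom_induced p X {} ?Z {} (\<lambda>x. y) z)"
    using hom_induced_compose_empty[of X ?Z "\<lambda>x. y" Y id p] by (simp add: o_def)
  have "trivial_group (homology_group p ?Z)"
  proof (cases "y \<in> topspace Y")
    case True
    then show ?thesis using p by (intro homology_dimension_axiom) auto
  next
    case False
    then show ?thesis by (intro trivial_homology_group_empty) auto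
  qed
  then show ?thesis
    unfolding * using hom_one[OF hom_induced_hom[of p ?Z "{}" Y "{}" id]] hom_induced_carrier[of p X
      "{}" ?Z "{}" "\<lambda>x. y" z]
    by (simp add: trivial_group_def)
qed

lemma hom_induced_compose_top_of_set:
  assumes "continuous_on S f" "f ` S \<subseteq> X" "continuous_on X g" "g ` X \<subseteq> Y"
  shows "hom_induced p (top_of_set X) {} (top_of_set Y) {} g (hom_induced p (top_of_set S) {}
    (top_of_set X) {} f z)
       = hom_induced p (top_of_set S) {} (top_of_set Y) {} (\<lambda>x. g (f x)) z"
  using hom_induced_compose'[of "top_of_set S" "top_of_set X" f "{}" "{}" "top_of_set Y" g "{}" p z] assms
  by (simp add: o_def image_subset_iff_funcset)

text \<open>Radial projection from q to the unit sphere is a left inverse of the map up to homotopy: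
  q can be slid to 0 along \<open>t *\<^sub>R q\<close>, which stays inside the sphere of radius R
  because \<open>norm q < R\<close>. Hence the map is injective on homology.\<close>

lemma sphere_around_point_nontrivial:
  fixes E :: "'a::euclidean_space set"
  assumes E: "subspace E" and q: "q \<in> E" "norm q < R"
    and g: "g \<in> carrier (homology_group p (top_of_set (sphere 0 1 \<inter> E)))"
      "g \<noteq> \<one>\<^bsub>homology_group p (top_of_set (sphere 0 1 \<inter> E))\<^esub>"
  shows "hom_induced p (top_of_set (sphere 0 1 \<inter> E)) {} (top_of_set (E - {q})) {} (\<lambda>s. R *\<^sub>R s) g
      \<noteq> \<one>\<^bsub>homology_group p (top_of_set (E - {q}))\<^esub>"
proof
  let ?S = "sphere 0 1 \<inter> E"
  let ?r = "\<lambda>v. (1 / norm (v - q)) *\<^sub>R (v - q)"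
  have R: "R > 0" using q(2) norm_ge_zero[of q] by linarith
  have ne: "R *\<^sub>R s - t *\<^sub>R q \<noteq> 0" if "s \<in> ?S" "t \<in> {0..1}" for s t
  proof
    assume "R *\<^sub>R s - t *\<^sub>R q = 0"
    then have "norm (R *\<^sub>R s) = norm (t *\<^sub>R q)" by simp
    then have "R = t * norm q" using that R by simp
    moreover have "t * norm q \<le> 1 * norm q" using that by (intro mult_right_mono) auto
    ultimately show False using q(2) by simp
  qed
  assume eq: "hom_induced p (top_of_set ?S) {} (top_of_set (E - {q})) {} (\<lambda>s. R *\<^sub>R s) g
      = \<one>\<^bsub>homology_group p (top_of_set (E - {q}))\<^esub>"
  let ?h = "\<lambda>t s. (1 / norm (R *\<^sub>R s - t *\<^sub>R q)) *\<^sub>R (R *\<^sub>R s - t *\<^sub>R q)"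
  have r: "?r v \<in> ?S" if "v \<in> E - {q}" for v
    using that q(1) by (auto intro!: subspace_scale[OF E] subspace_diff[OF E])
  have "hom_induced p (top_of_set (E - {q})) {} (top_of_set ?S) {} ?r
      (hom_induced p (top_of_set ?S) {} (top_of_set (E - {q})) {} (\<lambda>s. R *\<^sub>R s) g)
    = hom_induced p (top_of_set ?S) {} (top_of_set ?S) {} (\<lambda>s. ?r (R *\<^sub>R s)) g"
  proof (rule hom_induced_compose_top_of_set)
    show "(*\<^sub>R) R ` ?S \<subseteq> E - {q}" using ne[of _ 1] by (fastforce intro!: subspace_scale[OF E])
    show "?r ` (E - {q}) \<subseteq> ?S" using r by blast
  qed (auto intro!: continuous_intros)
  also have "\<dots> = hom_induced p (top_of_set ?S) {} (top_of_set ?S) {} (?h 1) g" by simp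
  also have "hom_induced p (top_of_set ?S) {} (top_of_set ?S) {} (?h 1)
      = hom_induced p (top_of_set ?S) {} (top_of_set ?S) {} (?h 0)"
  proof (rule hom_induced_homotopy[symmetric])
    show "continuous_on ({0..1} \<times> ?S) (\<lambda>(t, s). ?h t s)"
      unfolding case_prod_beta using ne by (intro continuous_intros) auto
    fix t :: real and s assume t: "t \<in> {0..1}" and s: "s \<in> ?S"
    have "?h t s \<in> E" using s q(1) by (intro subspace_scale[OF E] subspace_diff[OF E]) auto
    then show "?h t s \<in> ?S" using ne[OF s t] by simp
  qed
  also have "hom_induced p (top_of_set ?S) {} (top_of_set ?S) {} (?h 0)
      = hom_induced p (top_of_set ?S) {} (top_of_set ?S) {} id"
    using R by (intro hom_induced_eq) auto
  also have "hom_induced p (top_of_set ?S) {} (top_of_set ?S) {} id g = g" using g(1) by (rule hom_induced_id)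
  finally show False
    using g(2) eq hom_one[OF hom_induced_hom[of p "top_of_set (E - {q})" "{}" "top_of_set ?S" "{}" ?r]]
    by simp
qed

text \<open>An orthonormal basis of E identifies the sphere with \<open>nsphere (m - 1)\<close>,
  whose top reduced homology is nontrivial. For \<open>m \<ge> 2\<close> the degree is positive, so
  that reduced and ordinary homology agree.\<close>

lemma unit_sphere_homology_nontrivial:
  fixes E :: "'a::euclidean_space set"
  assumes E: "subspace E" and dim: "dim E = m" "m \<ge> 2"
  obtains g where "g \<in> carrier (homology_group (int m - 1) (top_of_set (sphere 0 1 \<inter> E)))"
    "g \<noteq> \<one>\<^bsub>homology_group (int m - 1) (top_of_set (sphere 0 1 \<inter> E))\<^esub>"
proof -
  obtain B where B: "B \<subseteq> E" "pairwise orthogonal B" "\<And>x. x \<in> B \<Longrightarrow> norm x = 1"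
      "independent B" "card B = dim E" "span B = E"
    using orthonormal_basis_subspace[OF E] by blast
  obtain f h where fh: "homeomorphic_maps (nsphere (m - 1)) (top_of_set (sphere 0 1 \<inter> span B)) f h"
    using homeomorphic_maps_nsphere_euclidean_sphere[OF B(4) B(2), of m] B(3,5) dim by auto
  have "nsphere (m - 1) homeomorphic_space top_of_set (sphere 0 1 \<inter> E)"
    using fh B(6) homeomorphic_space_def by blast
  then have iso: "reduced_homology_group (int m - 1) (nsphere (m - 1)) \<cong>
      reduced_homology_group (int m - 1) (top_of_set (sphere 0 1 \<inter> E))"
    by (rule homeomorphic_space_imp_isomorphic_reduced_homology_groups)
  have "\<not> trivial_group (reduced_homology_group (int m - 1) (nsphere (m - 1)))"
    using dim by (simp add: trivial_reduced_homology_group_nsphere of_nat_diff)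
  then have "\<not> trivial_group (reduced_homology_group (int m - 1) (top_of_set (sphere 0 1 \<inter> E)))"
    using isomorphic_group_triviality[OF iso] by simp
  then have "\<not> trivial_group (homology_group (int m - 1) (top_of_set (sphere 0 1 \<inter> E)))"
    using dim by (subst (asm) un_reduced_homology_group) auto
  then have "carrier (homology_group (int m - 1) (top_of_set (sphere 0 1 \<inter> E)))
      \<noteq> {\<one>\<^bsub>homology_group (int m - 1) (top_of_set (sphere 0 1 \<inter> E))\<^esub>}"
    by (simp add: trivial_group_def)
  moreover have "\<one>\<^bsub>homology_group (int m - 1) (top_of_set (sphere 0 1 \<inter> E))\<^esub>
      \<in> carrier (homology_group (int m - 1) (top_of_set (sphere 0 1 \<inter> E)))"
    by (intro monoid.one_closed group.is_monoid group_relative_homology_group)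
  ultimately show thesis using that by blast
qed

section \<open>Ellipsoids obtained by stretching a sphere in one direction\<close>

lemma stretch_eqD:
  fixes \<phi> :: "'a::real_vector \<Rightarrow> real"
  assumes \<phi>: "linear \<phi>" "\<phi> c = 1" and e: "e > 0" "k \<ge> 0"
    and eq: "e *\<^sub>R s + (k * \<phi> s) *\<^sub>R c = r *\<^sub>R c + y" and y: "\<phi> y = 0"
  shows "s = (r / (e + k)) *\<^sub>R c + (1 / e) *\<^sub>R y"
proof -
  \<comment> \<open>The stretching multiplies the component along c, which \<phi> measures, by e +
    k, and the kernel of \<phi> by e; this inverts it.\<close>
  have "\<phi> (e *\<^sub>R s + (k * \<phi> s) *\<^sub>R c) = (e + k) * \<phi> s"
    using \<phi> by (simp add: linear_add linear_scale algebra_simps)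
  moreover have "\<phi> (r *\<^sub>R c + y) = r" using \<phi> y by (simp add: linear_add linear_scale)
  ultimately have s: "\<phi> s = r / (e + k)" using eq e by (simp add: field_simps)
  have "e *\<^sub>R s = (r - k * \<phi> s) *\<^sub>R c + y" using eq by (simp add: algebra_simps)
  also have "r - k * \<phi> s = e * (r / (e + k))" unfolding s using e by (simp add: field_simps)
  finally have "(1 / e) *\<^sub>R (e *\<^sub>R s) = (1 / e) *\<^sub>R ((e * (r / (e + k))) *\<^sub>R c + y)" by simp
  then show ?thesis using e by (simp add: scaleR_add_right)
qed

text \<open>The point \<open>r *\<^sub>R c\<close> lies strictly inside the ellipsoid and
  \<open>r' *\<^sub>R c'\<close> strictly outside: their preimages under the stretching have norms
  \<open>\<bar>r\<bar> * norm c / (e + k)\<close> and \<open>\<bar>r'\<bar> * norm c' / e\<close>,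
  below and above 1.\<close>

lemma stretch_avoids:
  fixes \<phi> :: "'a::real_normed_vector \<Rightarrow> real"
  assumes \<phi>: "linear \<phi>" "\<phi> c = 1" "\<phi> c' = 0" and e: "e > 0" "k \<ge> 0"
    and s: "norm s = 1" and c: "\<bar>r\<bar> * norm c < e + k" "e < \<bar>r'\<bar> * norm c'"
  shows "e *\<^sub>R s + (k * \<phi> s) *\<^sub>R c \<noteq> r *\<^sub>R c \<and> e *\<^sub>R s + (k * \<phi> s) *\<^sub>R c \<noteq> r' *\<^sub>R c'"
proof (intro conjI notI)
  assume "e *\<^sub>R s + (k * \<phi> s) *\<^sub>R c = r *\<^sub>R c"
  then have "s = (r / (e + k)) *\<^sub>R c + (1 / e) *\<^sub>R 0"
    using \<phi> e by (intro stretch_eqD[OF \<phi>(1,2)]) (auto simp: linear_0)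
  then have "norm s = \<bar>r\<bar> * norm c / (e + k)" using e by simp
  then show False using s c e by (simp add: field_simps)
next
  assume "e *\<^sub>R s + (k * \<phi> s) *\<^sub>R c = r' *\<^sub>R c'"
  then have "s = (0 / (e + k)) *\<^sub>R c + (1 / e) *\<^sub>R (r' *\<^sub>R c')"
    using \<phi> e by (intro stretch_eqD[OF \<phi>(1,2)]) (auto simp: linear_scale)
  then have "norm s = \<bar>r'\<bar> * norm c' / e" using e by simp
  then show False using s c e by (simp add: field_simps)
qed

text \<open>Interpolating the coefficients passes through ellipsoids only. Their extent in direction
  c is governed by \<open>(1-t) * (e + k) + t * R\<close>, which exceeds \<open>norm c\<close>
  throughout, so that q stays strictly inside.\<close>

lemma stretched_sphere_homotopic_round:
  fixes E :: "'a::euclidean_space set"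
  assumes E: "subspace E" and \<phi>: "linear \<phi>" "\<phi> c = 1" and c: "c \<in> E" "norm c < e + k" "norm c < R"
    and e: "e > 0" "k \<ge> 0" and q: "q = c \<or> q = - c"
  shows "hom_induced p (top_of_set (sphere 0 1 \<inter> E)) {} (top_of_set (E - {q})) {} (\<lambda>s. e *\<^sub>R s + (k
    * \<phi> s) *\<^sub>R c) g
       = hom_induced p (top_of_set (sphere 0 1 \<inter> E)) {} (top_of_set (E - {q})) {} (\<lambda>s. R *\<^sub>R s) g"
proof -
  let ?S = "sphere 0 1 \<inter> E"
  let ?h = "\<lambda>t s. ((1-t) * e + t * R) *\<^sub>R s + ((1-t) * k * \<phi> s) *\<^sub>R c"
  have R: "R > 0" using c(3) norm_ge_zero[of c] by linarith
  have cont: "continuous_on A \<phi>" for A using \<phi>(1) by (simp add: linear_continuous_on linear_linear)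
  have "hom_induced p (top_of_set ?S) {} (top_of_set (E - {q})) {} (?h 0)
      = hom_induced p (top_of_set ?S) {} (top_of_set (E - {q})) {} (?h 1)"
  proof (rule hom_induced_homotopy)
    show "continuous_on ({0..1} \<times> ?S) (\<lambda>(t, s). ?h t s)"
      unfolding case_prod_beta
      by (intro continuous_intros continuous_on_compose2[OF cont[of UNIV]]) auto
    fix t :: real and s assume t: "t \<in> {0..1}" and s: "s \<in> ?S"
    have pos: "(1-t) * e + t * R > 0"
      using t e R by (cases "t = 1") (auto intro: add_pos_nonneg)
    have "?h t s \<noteq> q"
    proof
      assume "?h t s = q"
      moreover obtain r :: real where r: "\<bar>r\<bar> = 1" "q = r *\<^sub>R c"
        using q by (metis abs_1 abs_minus_cancel scaleR_minus_left scaleR_one)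
      ultimately have "s = (r / ((1-t) * e + t * R + (1-t) * k)) *\<^sub>R c + (1 / ((1-t) * e + t * R)) *\<^sub>R 0"
        using t e \<phi> by (intro stretch_eqD[OF \<phi> pos]) (auto simp: linear_0)
      moreover have "(1-t) * e + t * R + (1-t) * k = (1-t) * (e + k) + t * R"
        by (simp add: algebra_simps)
      moreover have "0 < (1-t) * e + t * R + (1-t) * k" using pos t e by (simp add: add_pos_nonneg)
      ultimately have "norm s = norm c / ((1-t) * (e + k) + t * R)"
        using r(1) by simp
      moreover have "norm c < (1-t) * (e + k) + t * R"
      proof -
        have "norm c = (1-t) * norm c + t * norm c" by (simp add: algebra_simps)
        also have "\<dots> < (1-t) * (e + k) + t * R"
        proof (cases "t = 1")
          case False
          then show ?thesis using t c by (intro add_less_le_mono mult_strict_left_mono mult_left_mono) auto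
        qed (use c in simp)
        finally show ?thesis .
      qed
      ultimately show False using s norm_ge_zero[of c]
        by (metis IntD1 dist_0_norm divide_eq_1_iff less_irrefl mem_sphere)
    qed
    moreover have "?h t s \<in> E" using s c E by (intro subspace_add subspace_scale) auto
    ultimately show "?h t s \<in> E - {q}" by simp
  qed
  then show ?thesis by simp
qed

text \<open>The ellipsoid is contracted to its centre. It meets the kernel of \<phi>, where q lies,
  only in norm e, and contraction lowers this norm further below \<open>norm q\<close>; so q is
  never hit.\<close>

lemma stretched_sphere_null:
  fixes E :: "'a::euclidean_space set"
  assumes E: "subspace E" and \<phi>: "linear \<phi>" "\<phi> c = 1" "\<phi> q = 0" and c: "c \<in> E" "e < norm q"
    and e: "e > 0" "k \<ge> 0" and p: "p \<noteq> 0"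
  shows "hom_induced p (top_of_set (sphere 0 1 \<inter> E)) {} (top_of_set (E - {q})) {} (\<lambda>s. e *\<^sub>R s + (k
    * \<phi> s) *\<^sub>R c) g
       = \<one>\<^bsub>homology_group p (top_of_set (E - {q}))\<^esub>"
proof -
  let ?S = "sphere 0 1 \<inter> E"
  let ?h = "\<lambda>t s. t *\<^sub>R (e *\<^sub>R s + (k * \<phi> s) *\<^sub>R c)"
  have cont: "continuous_on A \<phi>" for A using \<phi>(1) by (simp add: linear_continuous_on linear_linear)
  have "hom_induced p (top_of_set ?S) {} (top_of_set (E - {q})) {} (?h 0)
      = hom_induced p (top_of_set ?S) {} (top_of_set (E - {q})) {} (?h 1)"
  proof (rule hom_induced_homotopy)
    show "continuous_on ({0..1} \<times> ?S) (\<lambda>(t, s). ?h t s)"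
      unfolding case_prod_beta
      by (intro continuous_intros continuous_on_compose2[OF cont[of UNIV]]) auto
    fix t :: real and s assume t: "t \<in> {0..1}" and s: "s \<in> ?S"
    have "?h t s \<noteq> q"
    proof
      assume eq: "?h t s = q"
      then have t0: "t > 0" using t c e by (cases "t = 0") auto
      have "e *\<^sub>R s + (k * \<phi> s) *\<^sub>R c = 0 *\<^sub>R c + (1 / t) *\<^sub>R q"
        unfolding eq[symmetric] using t0 by simp
      then have "s = (0 / (e + k)) *\<^sub>R c + (1 / e) *\<^sub>R ((1 / t) *\<^sub>R q)"
        using \<phi> e by (intro stretch_eqD[OF \<phi>(1,2)]) (auto simp: linear_scale)
      then have "norm s = norm q / (e * t)" using t0 e by simp
      then have "e * t = norm q" using s t0 e by (simp add: field_simps)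
      moreover have "e * t \<le> e * 1" using t e by (intro mult_left_mono) auto
      ultimately show False using c by simp
    qed
    moreover have "?h t s \<in> E" using s c E by (intro subspace_add subspace_scale) auto
    ultimately show "?h t s \<in> E - {q}" by simp
  qed
  then show ?thesis
    using hom_induced_const[OF p, of "top_of_set ?S" "top_of_set (E - {q})" 0 g] by simp
qed

text \<open>It suffices to test the difference of both sides at each puncture separately. At c and
  -c the first ellipsoid is homotopic to the round sphere and the second is null; at c' and -c' the
  roles are exchanged.\<close>

lemma stretched_spheres_sum:
  fixes E :: "'a::euclidean_space set"
  assumes E: "subspace E" and p: "p > 0"
    and c: "c \<in> E" "c' \<in> E" "norm c < e + k" "norm c' < e + k" "norm c < R" "norm c' < R" "e < norm
      c" "e < norm c'"
    and \<phi>: "linear \<phi>" "\<phi> c = 1" "\<phi> c' = 0" and \<psi>: "linear \<psi>" "\<psi> c = 0" "\<psi> c' = 1"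
    and e: "e > 0" "k \<ge> 0"
    and g: "g \<in> carrier (homology_group p (top_of_set (sphere 0 1 \<inter> E)))"
  defines "h \<equiv> \<lambda>f. hom_induced p (top_of_set (sphere 0 1 \<inter> E)) {} (top_of_set (E - {c, -c, c', -c'})) {} f g"
  shows "h (\<lambda>s. e *\<^sub>R s + (k * \<phi> s) *\<^sub>R c) \<otimes>\<^bsub>homology_group p (top_of_set (E - {c, -c, c', -c'}))\<^esub>
         h (\<lambda>s. e *\<^sub>R s + (k * \<psi> s) *\<^sub>R c') = h (\<lambda>s. R *\<^sub>R s)"
proof -
  let ?S = "sphere 0 1 \<inter> E"
  let ?F = "{c, -c, c', -c'}"
  let ?Y = "homology_group p (top_of_set (E - ?F))"
  interpret Y: comm_group ?Y by (rule abelian_homology_group)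
  let ?a = "\<lambda>s. e *\<^sub>R s + (k * \<phi> s) *\<^sub>R c" and ?b = "\<lambda>s. e *\<^sub>R s + (k * \<psi> s) *\<^sub>R c'" and ?r = "\<lambda>s. R *\<^sub>R s"
  have [simp]: "h f \<in> carrier ?Y" for f unfolding h_def by (rule hom_induced_carrier)
  have cont: "continuous_on A \<phi>" "continuous_on A \<psi>" for A
    using \<phi>(1) \<psi>(1) by (simp_all add: linear_continuous_on linear_linear)
  let ?z = "h ?a \<otimes>\<^bsub>?Y\<^esub> h ?b \<otimes>\<^bsub>?Y\<^esub> inv\<^bsub>?Y\<^esub> h ?r"
  have R: "R > 0" using c(5) norm_ge_zero[of c] by linarith
  have av: "?a s \<in> E - ?F" if "s \<in> ?S" for s
  proof -
    have "?a s \<noteq> r *\<^sub>R c \<and> ?a s \<noteq> r *\<^sub>R c'" if "\<bar>r\<bar> = 1" for r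
      using stretch_avoids[OF \<phi> e, of s r r] c that \<open>s \<in> ?S\<close> by simp
    from this[of 1] this[of "-1"] have "?a s \<notin> ?F" by simp
    moreover have "?a s \<in> E" using that c by (intro subspace_add[OF E] subspace_scale[OF E]) auto
    ultimately show ?thesis by simp
  qed
  have bv: "?b s \<in> E - ?F" if "s \<in> ?S" for s
  proof -
    have "?b s \<noteq> r *\<^sub>R c' \<and> ?b s \<noteq> r *\<^sub>R c" if "\<bar>r\<bar> = 1" for r
      using stretch_avoids[OF \<psi>(1,3,2) e, of s r r] c that \<open>s \<in> ?S\<close> by simp
    from this[of 1] this[of "-1"] have "?b s \<notin> ?F" by simp
    moreover have "?b s \<in> E" using that c by (intro subspace_add[OF E] subspace_scale[OF E]) auto
    ultimately show ?thesis by simp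
  qed
  have rv: "?r s \<in> E - ?F" if "s \<in> ?S" for s
  proof -
    have "norm (?r s) = R" "?r s \<in> E" using that R by (auto intro: subspace_scale[OF E])
    moreover have "norm q < R" if "q \<in> ?F" for q using that c by auto
    ultimately show ?thesis by (metis Diff_iff less_irrefl)
  qed
  have "?z = \<one>\<^bsub>?Y\<^esub>"
  proof (rule homology_class_punctured_trivial[OF _ subspace_imp_convex[OF E] p])
    fix q assume q: "q \<in> ?F"
    let ?Q = "homology_group p (top_of_set (E - {q}))"
    let ?i = "hom_induced p (top_of_set (E - ?F)) {} (top_of_set (E - {q})) {} id"
    let ?j = "\<lambda>f. hom_induced p (top_of_set ?S) {} (top_of_set (E - {q})) {} f g"
    interpret i: group_hom ?Y ?Q ?i
      by (simp add: group_hom_def group_hom_axioms_def hom_induced_empty_hom)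
    interpret Q: comm_group ?Q by (rule abelian_homology_group)
    have push: "?i (h f) = ?j f" if "continuous_on ?S f" "f ` ?S \<subseteq> E - ?F" for f
      unfolding h_def using that q
      by (subst hom_induced_compose_top_of_set) (auto intro: continuous_on_id)
    have iz: "?i ?z = ?j ?a \<otimes>\<^bsub>?Q\<^esub> ?j ?b \<otimes>\<^bsub>?Q\<^esub> inv\<^bsub>?Q\<^esub> ?j ?r"
    proof -
      have "?i (h ?a) = ?j ?a" "?i (h ?b) = ?j ?b" "?i (h ?r) = ?j ?r"
        using av bv rv by (intro push; force intro!: continuous_intros cont)+
      then show ?thesis by simp
    qed
    have [simp]: "?j f \<in> carrier ?Q" for f by (rule hom_induced_carrier)
    show "?i ?z = \<one>\<^bsub>?Q\<^esub>"
    proof (cases "q = c \<or> q = - c")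
      case True
      have "?j ?a = ?j ?r" by (rule stretched_sphere_homotopic_round) (use assms True in auto)
      moreover have "?j ?b = \<one>\<^bsub>?Q\<^esub>"
        by (rule stretched_sphere_null) (use assms True in \<open>auto simp: linear_neg\<close>)
      ultimately show ?thesis unfolding iz by simp
    next
      case False
      then have q': "q = c' \<or> q = - c'" using q by simp
      have "?j ?b = ?j ?r" by (rule stretched_sphere_homotopic_round) (use assms q' in auto)
      moreover have "?j ?a = \<one>\<^bsub>?Q\<^esub>"
        by (rule stretched_sphere_null) (use assms q' in \<open>auto simp: linear_neg\<close>)
      ultimately show ?thesis unfolding iz by simp
    qed
  qed simp_all
  then have "h ?a \<otimes>\<^bsub>?Y\<^esub> h ?b = \<one>\<^bsub>?Y\<^esub> \<otimes>\<^bsub>?Y\<^esub> h ?r"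
    by (intro Y.inv_solve_right[THEN iffD1, OF _ _ _ sym]) simp_all
  then show ?thesis by simp
qed

section \<open>Sign cells of linear forms\<close>

lemma subspace_coordinates: "subspace {p :: real^'n::finite. \<forall>l. l \<notin> K \<longrightarrow> p $ l = 0}"
  by (auto simp: subspace_def)

lemma dim_coordinates: "dim {p :: real^'n::finite. \<forall>l. l \<notin> K \<longrightarrow> p $ l = 0} = card K"
  using dim_substandard_cart[of K, where 'a = real] by (simp add: dim_vec_eq)

text \<open>For x in W and finitely many linear forms on a subspace W, this is the closed cell of
  the arrangement of hyperplanes \<open>f j = 0\<close> that has x in its relative interior. A
  representing point instead of a sign vector ensures that the signs are realised.\<close>

definition sign_cell :: "'j set \<Rightarrow> ('j \<Rightarrow> 'a::real_vector \<Rightarrow> real) \<Rightarrow> 'a set \<Rightarrow> 'a \<Rightarrow> 'a set" where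
  "sign_cell J f W x = {p \<in> W. \<forall>j\<in>J. 0 \<le> sgn (f j x) * f j p \<and> (f j x = 0 \<longrightarrow> f j p = 0)}"

lemma sign_cell_self: "x \<in> W \<Longrightarrow> x \<in> sign_cell J f W x"
  by (auto simp: sign_cell_def sgn_if)

lemma sign_cell_mono:
  assumes "\<And>j. j \<in> J \<Longrightarrow> f j x = 0 \<or> sgn (f j x) = sgn (f j y)"
  shows "sign_cell J f W x \<subseteq> sign_cell J f W y"
proof
  fix p assume p: "p \<in> sign_cell J f W x"
  have "0 \<le> sgn (f j y) * f j p \<and> (f j y = 0 \<longrightarrow> f j p = 0)" if "j \<in> J" for j
    using p assms[OF that] that by (auto simp: sign_cell_def sgn_0_0)
  then show "p \<in> sign_cell J f W y" using p by (simp add: sign_cell_def)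
qed

lemma sign_cell_cong:
  assumes "\<And>j. j \<in> J \<Longrightarrow> sgn (f j x) = sgn (f j y)"
  shows "sign_cell J f W x = sign_cell J f W y"
  using assms by (intro subset_antisym sign_cell_mono) auto

lemma convex_sign_cell:
  assumes W: "subspace W" and f: "\<And>j. j \<in> J \<Longrightarrow> linear (f j)"
  shows "convex (sign_cell J f W x)"
  unfolding convex_def
proof (intro ballI allI impI)
  fix p q and u v :: real
  assume p: "p \<in> sign_cell J f W x" and q: "q \<in> sign_cell J f W x" and uv: "0 \<le> u" "0 \<le> v"
  have "0 \<le> u * (sgn (f j x) * f j p) + v * (sgn (f j x) * f j q)" if "j \<in> J" for j
    using p q uv that by (simp add: sign_cell_def)
  then show "u *\<^sub>R p + v *\<^sub>R q \<in> sign_cell J f W x"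
    using p q W f by (auto simp: sign_cell_def linear_add linear_scale algebra_simps intro!:
      subspace_add subspace_scale)
qed

text \<open>On the cell each \<open>sgn (f j x) * f j\<close> is nonnegative, so if it vanishes in
  the interior of a segment of the cell, it vanishes at both ends.\<close>

lemma sign_cell_vanishing_face:
  assumes W: "subspace W" and f: "\<And>j. j \<in> J \<Longrightarrow> linear (f j)" and I: "I \<subseteq> J"
  shows "{p \<in> sign_cell J f W x. \<forall>j\<in>I. f j p = 0} face_of sign_cell J f W x"
  unfolding face_of_def
proof (intro conjI ballI impI)
  have "{p \<in> sign_cell J f W x. \<forall>j\<in>I. f j p = 0} = sign_cell J f W x \<inter> (\<Inter>j\<in>I. {p. f j p = 0})" by auto
  moreover have "convex {p. f j p = 0}" if "j \<in> I" for j
    using f[of j] I that by (intro subspace_imp_convex linear_subspace_kernel) auto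
  ultimately show "convex {p \<in> sign_cell J f W x. \<forall>j\<in>I. f j p = 0}"
    by (simp add: convex_Int convex_INT convex_sign_cell[OF W f])
  fix p q r
  assume p: "p \<in> sign_cell J f W x" and q: "q \<in> sign_cell J f W x"
    and r: "r \<in> {p \<in> sign_cell J f W x. \<forall>j\<in>I. f j p = 0}" and seg: "r \<in> open_segment p q"
  obtain u where u: "0 < u" "u < 1" "r = (1 - u) *\<^sub>R p + u *\<^sub>R q"
    using seg by (auto simp: in_segment)
  have "f j p = 0 \<and> f j q = 0" if j: "j \<in> I" for j
  proof (cases "f j x = 0")
    case True
    then show ?thesis using p q j I by (auto simp: sign_cell_def)
  next
    case False
    have "(1 - u) * f j p + u * f j q = 0"
      using r j linear_add[OF f[of j]] linear_scale[OF f[of j]] subsetD[OF I j] unfolding u(3) by auto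
    then have "sgn (f j x) * ((1 - u) * f j p + u * f j q) = 0" by simp
    then have "(1 - u) * (sgn (f j x) * f j p) + u * (sgn (f j x) * f j q) = 0"
      by (simp only: distrib_left mult.left_commute)
    moreover have "0 \<le> sgn (f j x) * f j p" "0 \<le> sgn (f j x) * f j q"
      using p q j I by (auto simp: sign_cell_def)
    ultimately have "(1 - u) * (sgn (f j x) * f j p) = 0" "u * (sgn (f j x) * f j q) = 0"
      using u by (auto simp: add_nonneg_eq_0_iff)
    then show ?thesis using u False by (simp add: sgn_0_0)
  qed
  then show "p \<in> {p \<in> sign_cell J f W x. \<forall>j\<in>I. f j p = 0}" "q \<in> {p \<in> sign_cell J f W x. \<forall>j\<in>I. f j p = 0}"
    using p q by auto
qed auto

text \<open>Forms that are nonzero at x keep their sign nearby, so near x the cell is cut out of W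
  by equations alone.\<close>

lemma sign_cell_neighbourhood:
  fixes f :: "'j \<Rightarrow> 'a::euclidean_space \<Rightarrow> real"
  assumes J: "finite J" and f: "\<And>j. j \<in> J \<Longrightarrow> linear (f j)"
  obtains U where "open U" "x \<in> U"
    "U \<inter> {p \<in> W. \<forall>j\<in>J. f j x = 0 \<longrightarrow> f j p = 0} \<subseteq> sign_cell J f W x"
proof
  let ?U = "\<Inter>j\<in>{j\<in>J. f j x \<noteq> 0}. {p. 0 < sgn (f j x) * f j p}"
  show "open ?U"
    using J f by (intro open_INT)
      (auto intro!: open_Collect_less continuous_intros simp: linear_continuous_on linear_linear)
  show "x \<in> ?U" by (auto simp: sgn_if)
  show "?U \<inter> {p \<in> W. \<forall>j\<in>J. f j x = 0 \<longrightarrow> f j p = 0} \<subseteq> sign_cell J f W x"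
    by (fastforce simp: sign_cell_def)
qed

lemma affine_hull_sign_cell:
  fixes f :: "'j \<Rightarrow> 'a::euclidean_space \<Rightarrow> real"
  assumes J: "finite J" and f: "\<And>j. j \<in> J \<Longrightarrow> linear (f j)" and W: "subspace W" and x: "x \<in> W"
  shows "affine hull (sign_cell J f W x) = {p \<in> W. \<forall>j\<in>J. f j x = 0 \<longrightarrow> f j p = 0}" (is "_ = ?A")
proof
  have "?A = W \<inter> (\<Inter>j\<in>{j\<in>J. f j x = 0}. {p. f j p = 0})" by auto
  moreover have "subspace {p. f j p = 0}" if "j \<in> J" for j
    using f[OF that] by (rule linear_subspace_kernel)
  ultimately have A: "subspace ?A" using W by (auto intro!: subspace_inter subspace_Int)
  then show "affine hull (sign_cell J f W x) \<subseteq> ?A"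
    by (intro hull_minimal subspace_imp_affine) (auto simp: sign_cell_def)
  obtain U where U: "open U" "x \<in> U"
    "U \<inter> ?A \<subseteq> sign_cell J f W x"
    using sign_cell_neighbourhood[OF J f] .
  have "?A \<inter> U \<noteq> {}" using U x by auto
  then have "affine hull (?A \<inter> U) = affine hull ?A"
    using affine_hull_convex_Int_open[OF subspace_imp_convex[OF A] U(1)] by simp
  also have "\<dots> = ?A" using A by (simp add: affine_hull_eq subspace_imp_affine)
  finally show "?A \<subseteq> affine hull (sign_cell J f W x)"
    using hull_mono[of "?A \<inter> U" "sign_cell J f W x" affine] U(3) by (simp add: Int_commute)
qed

text \<open>The representing point is any y in the relative interior of the face. Points of the face
  are compared with y by extending segments beyond y inside the face; conversely, a segment from a
  point of the sign cell of y extends beyond y inside that cell, and the face property at y captures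
  both ends.\<close>

lemma face_of_sign_cell:
  fixes f :: "'j \<Rightarrow> 'a::euclidean_space \<Rightarrow> real"
  assumes J: "finite J" and f: "\<And>j. j \<in> J \<Longrightarrow> linear (f j)" and W: "subspace W"
    and \<tau>: "\<tau> face_of sign_cell J f W x" "\<tau> \<noteq> {}"
  obtains y where "y \<in> \<tau>" "\<tau> = sign_cell J f W y"
proof -
  have conv: "convex \<tau>" using \<tau>(1) by (rule face_of_imp_convex)
  then obtain y where y: "y \<in> rel_interior \<tau>" using \<tau>(2) rel_interior_eq_empty by blast
  have y\<tau>: "y \<in> \<tau>" using y rel_interior_subset by blast
  have sub: "\<tau> \<subseteq> sign_cell J f W x" using \<tau>(1) by (rule face_of_imp_subset)
  then have yW: "y \<in> W" using y\<tau> by (auto simp: sign_cell_def)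
  have "\<tau> = sign_cell J f W y"
  proof
    show "\<tau> \<subseteq> sign_cell J f W y"
    proof
      fix p assume p: "p \<in> \<tau>"
      \<comment> \<open>A form that vanishes at y takes values of opposite sign at p and at this
        point beyond y; as both lie in the cell of x, it vanishes at p.\<close>
      obtain e where e: "e > 1" "(1 - e) *\<^sub>R p + e *\<^sub>R y \<in> \<tau>"
        using convex_rel_interior_if2[OF conv y] hull_inc[OF p] by meson
      have px: "p \<in> sign_cell J f W x" and yx: "y \<in> sign_cell J f W x"
        and qx: "(1 - e) *\<^sub>R p + e *\<^sub>R y \<in> sign_cell J f W x" using p y\<tau> e sub by auto
      have "0 \<le> sgn (f j y) * f j p \<and> (f j y = 0 \<longrightarrow> f j p = 0)" if j: "j \<in> J" for j
      proof (cases "f j y = 0")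
        case True
        have "0 \<le> sgn (f j x) * ((1 - e) * f j p)"
          using qx j linear_add[OF f[OF j]] linear_scale[OF f[OF j]] True by (auto simp: sign_cell_def)
        then have "(e - 1) * (sgn (f j x) * f j p) \<le> 0" by (simp add: algebra_simps)
        then have "sgn (f j x) * f j p \<le> 0" using e(1) by (simp add: mult_le_0_iff)
        then have "sgn (f j x) * f j p = 0" using px j by (auto simp: sign_cell_def)
        then show ?thesis using px j True by (auto simp: sign_cell_def sgn_0_0)
      next
        case False
        then have "sgn (f j y) = sgn (f j x)"
          using yx j by (fastforce simp: sign_cell_def sgn_if split: if_splits)
        then show ?thesis using px j False by (auto simp: sign_cell_def)
      qed
      then show "p \<in> sign_cell J f W y" using px by (simp add: sign_cell_def)
    qed
    show "sign_cell J f W y \<subseteq> \<tau>"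
    proof
      fix p assume p: "p \<in> sign_cell J f W y"
      have subyx: "sign_cell J f W y \<subseteq> sign_cell J f W x"
      proof (rule sign_cell_mono)
        fix j assume "j \<in> J"
        then show "f j y = 0 \<or> sgn (f j y) = sgn (f j x)"
          using y\<tau> sub by (fastforce simp: sign_cell_def sgn_if split: if_splits)
      qed
      obtain U where U: "open U" "y \<in> U"
        "U \<inter> {p \<in> W. \<forall>j\<in>J. f j y = 0 \<longrightarrow> f j p = 0} \<subseteq> sign_cell J f W y"
        using sign_cell_neighbourhood[OF J f] .
      obtain r where r: "r > 0" "ball y r \<subseteq> U" using U(1,2) openE by blast
      \<comment> \<open>The point q lies beyond y on the line from p, at distance less than r from
        y; the summand 1 keeps the denominator positive for p = y.\<close>
      define t where "t = r / (2 * (1 + norm (y - p)))"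
      define q where "q = y + t *\<^sub>R (y - p)"
      have np: "1 + norm (y - p) > 0" by (simp add: add_pos_nonneg)
      have t: "t > 0" using r(1) np by (simp add: t_def)
      have "norm (t *\<^sub>R (y - p)) = r * (norm (y - p) / (2 * (1 + norm (y - p))))" using r(1) np
        by (simp add: t_def)
      also have "\<dots> < r * 1" using r(1) np by (intro mult_strict_left_mono) (auto simp: field_simps)
      finally have "q \<in> ball y r" by (simp add: q_def dist_norm)
      moreover have "f j q = 0" if "j \<in> J" "f j y = 0" for j
        using that p linear_add[OF f] linear_scale[OF f] linear_diff[OF f] by (auto simp: q_def sign_cell_def)
      moreover have "q \<in> W" using yW p W by (auto simp: q_def sign_cell_def intro!: subspace_add
        subspace_scale subspace_diff)
      ultimately have q: "q \<in> sign_cell J f W y" using U(3) r(2) by blast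
      show "p \<in> \<tau>"
      proof (cases "p = y")
        case True
        then show ?thesis using y\<tau> by simp
      next
        case False
        have "y = (1 - 1 / (1 + t)) *\<^sub>R p + (1 / (1 + t)) *\<^sub>R q"
        proof -
          have "(1 + t) *\<^sub>R y = t *\<^sub>R p + q" by (simp add: q_def algebra_simps)
          then have "(1 / (1 + t)) *\<^sub>R ((1 + t) *\<^sub>R y) = (1 / (1 + t)) *\<^sub>R (t *\<^sub>R p + q)" by simp
          moreover have "1 - 1 / (1 + t) = t / (1 + t)" using t by (simp add: field_simps)
          ultimately show ?thesis using t by (simp add: scaleR_add_right)
        qed
        moreover have "p \<noteq> q"
        proof
          assume "p = q"
          then have "(1 + t) *\<^sub>R (y - p) = 0" by (simp add: q_def algebra_simps)
          then show False using t False by simp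
        qed
        ultimately have "y \<in> open_segment p q"
          using t by (auto simp: in_segment intro!: exI[of _ "1 / (1 + t)"])
        then show ?thesis using face_ofD[OF \<tau>(1)] y\<tau> p q subyx by blast
      qed
    qed
  qed
  then show thesis using that y\<tau> by blast
qed

lemma direction_space_affine_hull_subspace:
  assumes "affine hull S = W" "subspace W"
  shows "direction_space S = W"
  unfolding direction_space_def assms(1)
proof
  show "{x - y |x y. x \<in> W \<and> y \<in> W} \<subseteq> W" using assms(2) by (auto intro: subspace_diff)
  show "W \<subseteq> {x - y |x y. x \<in> W \<and> y \<in> W}"
    using subspace_0[OF assms(2)] by force
qed

lemma dim_kernel_section:
  fixes f :: "'a::euclidean_space \<Rightarrow> real"
  assumes W: "subspace W" and f: "linear f" and u: "u \<in> W" "f u \<noteq> 0"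
  shows "dim {p \<in> W. f p = 0} + 1 = dim W"
proof -
  let ?N = "{p \<in> W. f p = 0}"
  have "?N = W \<inter> {p. f p = 0}" by auto
  then have N: "subspace ?N" using W linear_subspace_kernel[OF f] by (simp add: subspace_inter)
  have "W \<subseteq> span (insert u ?N)"
  proof
    fix p assume p: "p \<in> W"
    have "p - (f p / f u) *\<^sub>R u \<in> ?N"
      using p u W f by (auto simp: linear_diff linear_scale intro!: subspace_diff subspace_scale)
    then show "p \<in> span (insert u ?N)"
      unfolding span_breakdown_eq by (intro exI[of _ "f p / f u"] span_base)
  qed
  moreover have "span (insert u ?N) \<subseteq> W" using u W by (intro span_minimal) auto
  ultimately have "dim W = dim (insert u ?N)" by (metis dim_span subset_antisym)
  also have "\<dots> = dim ?N + 1"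
    using u N by (simp add: dim_insert span_eq_iff[THEN iffD2, OF N])
  finally show ?thesis by simp
qed

section \<open>Closure properties of rational polyhedra\<close>

lemma rational_polyhedron_Int:
  assumes "rational_polyhedron S" "rational_polyhedron T"
  shows "rational_polyhedron (S \<inter> T)"
proof -
  obtain F where F: "finite F" "S = \<Inter>F" "\<forall>h\<in>F. \<exists>a b. a \<noteq> 0 \<and> (\<forall>i. a $ i \<in> \<rat>) \<and> h = {x. a \<bullet> x \<le> b}"
    using assms(1) unfolding rational_polyhedron_def by blast
  obtain G where G: "finite G" "T = \<Inter>G" "\<forall>h\<in>G. \<exists>a b. a \<noteq> 0 \<and> (\<forall>i. a $ i \<in> \<rat>) \<and> h = {x. a \<bullet> x \<le> b}"
    using assms(2) unfolding rational_polyhedron_def by blast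
  have "finite (F \<union> G)" "S \<inter> T = \<Inter>(F \<union> G)" using F(1,2) G(1,2) by (simp_all add: Inter_Un_distrib)
  moreover have "\<forall>h\<in>F \<union> G. \<exists>a b. a \<noteq> 0 \<and> (\<forall>i. a $ i \<in> \<rat>) \<and> h = {x. a \<bullet> x \<le> b}"
    using F(3) G(3) by (simp add: ball_Un)
  ultimately show ?thesis unfolding rational_polyhedron_def by (intro exI[of _ "F \<union> G"]) simp
qed

lemma rational_polyhedron_UNIV: "rational_polyhedron UNIV"
  unfolding rational_polyhedron_def by (intro exI[of _ "{}"]) auto

lemma rational_polyhedron_INT:
  "finite I \<Longrightarrow> (\<And>i. i \<in> I \<Longrightarrow> rational_polyhedron (S i)) \<Longrightarrow> rational_polyhedron (\<Inter>i\<in>I. S i)"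
  by (induction I rule: finite_induct) (auto intro: rational_polyhedron_UNIV rational_polyhedron_Int)

text \<open>A half-space in the definition has a nonzero normal; for a = 0 the set is the whole
  space, which is the empty intersection.\<close>

lemma rational_polyhedron_halfspace:
  assumes "\<And>i. a $ i \<in> \<rat>"
  shows "rational_polyhedron {x. a \<bullet> x \<le> 0}"
proof (cases "a = 0")
  case True
  then show ?thesis using rational_polyhedron_UNIV by simp
next
  case False
  then show ?thesis unfolding rational_polyhedron_def using assms
    by (intro exI[of _ "{{x. a \<bullet> x \<le> 0}}"]) auto
qed

lemma rational_polyhedron_hyperplane:
  assumes "\<And>i. a $ i \<in> \<rat>"
  shows "rational_polyhedron {x. a \<bullet> x = 0}"
proof -
  have "{x. a \<bullet> x = 0} = {x. a \<bullet> x \<le> 0} \<inter> {x. (- a) \<bullet> x \<le> 0}" by auto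
  moreover have "rational_polyhedron {x. (- a) \<bullet> x \<le> 0}"
    using assms by (intro rational_polyhedron_halfspace) simp
  ultimately show ?thesis
    using rational_polyhedron_Int[OF rational_polyhedron_halfspace[of a]] assms by simp
qed

section \<open>The threefold fan\<close>

lemma less_3_cases: "(j::nat) < 3 \<longleftrightarrow> j = 0 \<or> j = 1 \<or> j = 2" by auto

text \<open>
  The coordinates in \<open>K\<close> span the base, the others the fibre of the projection; \<open>ell j\<close> are the
  three forms on the base, \<open>cvec j\<close> the three fibre directions and \<open>fib\<close> the projection to the
  fibre. A cell is determined by the signs of \<open>ell\<close> at a point \<open>x\<close> and by a sheet \<open>(i, s)\<close>, the
  graph of \<open>s * ell i\<close> in direction \<open>cvec i\<close>; for \<open>s = 0\<close> the index \<open>i\<close> is irrelevant.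
\<close>

locale threefold_fan =
  fixes K :: "'n::finite set" and a b c d :: 'n
  assumes ab: "a \<in> K" "b \<in> K" "a \<noteq> b" and cd: "c \<notin> K" "d \<notin> K" "c \<noteq> d"
begin

definition ell :: "nat \<Rightarrow> real^'n \<Rightarrow> real" where
  "ell j p = (if j = 0 then p $ a else if j = 1 then p $ b else - p $ a - p $ b)"

definition cvec :: "nat \<Rightarrow> real^'n" where
  "cvec j = (if j = 0 then axis c 1 else if j = 1 then axis d 1 else - axis c 1 - axis d 1)"

definition fib :: "real^'n \<Rightarrow> real^'n" where
  "fib p = (\<chi> i. if i \<in> K then 0 else p $ i)"

definition lift :: "nat \<Rightarrow> real \<Rightarrow> (real^'n) set" where
  "lift i s = {p. fib p = (s * ell i p) *\<^sub>R cvec i}"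

text \<open>The linear projection onto \<open>lift i s\<close> along the fibre: the base part is
  kept and the fibre part replaced by the prescribed one.\<close>

definition lifted :: "nat \<Rightarrow> real \<Rightarrow> real^'n \<Rightarrow> real^'n" where
  "lifted i s p = p - fib p + (s * ell i p) *\<^sub>R cvec i"

definition cell :: "real^'n \<Rightarrow> nat \<Rightarrow> real \<Rightarrow> (real^'n) set" where
  "cell x i s = sign_cell {..<3} ell (lift i s) x"

definition few_positive :: "real^'n \<Rightarrow> bool" where
  "few_positive x \<longleftrightarrow> (\<forall>j<3. \<forall>j'<3. 0 < ell j x \<and> 0 < ell j' x \<longrightarrow> j = j')"

text \<open>Positivity is strict for the half-sheets because on the wall \<open>ell i = 0\<close>
  they meet the flat sheet; a point there is recorded as a point of the flat sheet. The closed cells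
  contain these boundary points nevertheless.\<close>

definition valid :: "real^'n \<Rightarrow> nat \<Rightarrow> real \<Rightarrow> bool" where
  "valid x i s \<longleftrightarrow> i < 3 \<and> x \<in> lift i s \<and> (s = 0 \<and> few_positive x \<or> \<bar>s\<bar> = 1 \<and> 0 < ell i x)"

definition cells :: "(real^'n) set set" where
  "cells = {cell x i s | x i s. valid x i s}"

section \<open>Linear algebra of the sheets\<close>

lemma linear_ell: "linear (ell j)"
  by (rule linearI) (auto simp: ell_def algebra_simps)

lemma linear_fib: "linear fib"
  by (rule linearI) (auto simp: fib_def vec_eq_iff)

lemmas ell_add = linear_add[OF linear_ell] and ell_diff = linear_diff[OF linear_ell]
  and ell_scale = linear_scale[OF linear_ell]
  and fib_add = linear_add[OF linear_fib] and fib_diff = linear_diff[OF linear_fib]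
  and fib_scale = linear_scale[OF linear_fib]

lemma linear_lifted: "linear (lifted i s)"
  by (rule linearI) (simp_all add: lifted_def ell_add ell_scale fib_add fib_scale algebra_simps)

lemma ell_sum: "ell 0 p + ell 1 p + ell 2 p = 0"
  by (simp add: ell_def)

lemma ell_cvec [simp]: "ell j (cvec i) = 0"
  using ab cd by (auto simp: ell_def cvec_def axis_def)

lemma fib_cvec [simp]: "fib (cvec i) = cvec i"
  using ab cd by (auto simp: fib_def cvec_def axis_def vec_eq_iff)

lemma fib_fib [simp]: "fib (fib p) = fib p"
  by (simp add: fib_def vec_eq_iff)

lemma ell_fib [simp]: "ell j (fib p) = 0"
  using ab by (simp add: ell_def fib_def)

lemma ell_lifted [simp]: "ell j (lifted i s p) = ell j p"
  by (simp add: lifted_def ell_add ell_diff ell_scale)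

lemma lifted_in_lift: "lifted i s p \<in> lift i s"
  by (simp add: lift_def ell_add ell_diff ell_scale) (simp add: lifted_def fib_add fib_diff fib_scale)

lemma cvec_independent:
  assumes "i < 3" "i' < 3" "i \<noteq> i'" "r *\<^sub>R cvec i = r' *\<^sub>R cvec i'"
  shows "r = 0" "r' = 0"
proof -
  have "(r *\<^sub>R cvec i) $ c = (r' *\<^sub>R cvec i') $ c" "(r *\<^sub>R cvec i) $ d = (r' *\<^sub>R cvec i') $ d"
    using assms(4) by simp_all
  then have "r = 0 \<and> r' = 0"
    using assms(1-3) cd unfolding less_3_cases by (elim disjE) (auto simp: cvec_def axis_def)
  then show "r = 0" "r' = 0" by auto
qed

lemma cvec_nonzero [simp]: "cvec i \<noteq> 0"
proof
  assume "cvec i = 0"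
  then have "cvec i $ c = 0" "cvec i $ d = 0" by simp_all
  then show False using cd by (auto simp: cvec_def axis_def split: if_splits)
qed

lemma subspace_lift: "subspace (lift i s)"
  unfolding lift_def subspace_def
  by (auto simp: fib_add fib_scale linear_0[OF linear_fib] linear_0[OF linear_ell] ell_add ell_scale
    algebra_simps)

lemma lift_zero: "lift i 0 = lift i' 0"
  by (simp add: lift_def)

lemma lift_vanishing: "ell i p = 0 \<Longrightarrow> p \<in> lift i s \<longleftrightarrow> p \<in> lift 0 0"
  by (simp add: lift_def)

lemma cell_zero: "cell x i 0 = cell x i' 0"
  by (simp add: cell_def lift_zero[of i i'])

text \<open>If \<open>ell i\<close> vanishes at x, it vanishes on the whole cell, and there every
  graph of a multiple of \<open>ell i\<close> is flat.\<close>

lemma cell_vanishing: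
  assumes "i < 3" "ell i x = 0"
  shows "cell x i s = cell x 0 0"
  using assms lift_vanishing[of i] by (fastforce simp: cell_def sign_cell_def)

section \<open>The cells form a finite rational polyhedral complex\<close>

lemma valid_self: "valid x i s \<Longrightarrow> x \<in> cell x i s"
  unfolding cell_def valid_def by (simp add: sign_cell_self)

lemma sgn_cellD:
  assumes "p \<in> cell x i s" "j < 3"
  shows "ell j p = 0 \<or> sgn (ell j p) = sgn (ell j x)"
proof -
  have "0 \<le> sgn (ell j x) * ell j p \<and> (ell j x = 0 \<longrightarrow> ell j p = 0)"
    using assms by (simp add: cell_def sign_cell_def)
  then show ?thesis by (auto simp: sgn_if split: if_splits)
qed

text \<open>On the wall \<open>ell i = 0\<close> of a half-sheet the point moves to the flat sheet.
  This is allowed because the two other forms sum to 0 there, so at most one of them is positive.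
  The lemma yields closure under faces and describes the union of the cells.\<close>

lemma valid_in_cell:
  assumes v: "valid x i s" and p: "p \<in> cell x i s"
  shows "\<exists>i' s'. valid p i' s' \<and> cell p i s = cell p i' s'"
proof -
  have i: "i < 3" and pl: "p \<in> lift i s" using v p by (auto simp: valid_def cell_def sign_cell_def)
  show ?thesis
  proof (cases "s = 0")
    case True
    then have "few_positive x" using v by (simp add: valid_def)
    moreover have "0 < ell j x" if "j < 3" "0 < ell j p" for j
      using sgn_cellD[OF p that(1)] that(2) by (auto simp: sgn_if split: if_splits)
    ultimately have "few_positive p" by (simp add: few_positive_def)
    then have "valid p i s" using True pl i by (simp add: valid_def)
    then show ?thesis by blast
  next
    case False
    then have s: "\<bar>s\<bar> = 1" "0 < ell i x" using v by (auto simp: valid_def)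
    show ?thesis
    proof (cases "ell i p = 0")
      case True
      have "few_positive p"
        using True i ell_sum[of p] unfolding few_positive_def less_3_cases by auto
      then have "valid p 0 0" using pl lift_vanishing[OF True] by (simp add: valid_def)
      then show ?thesis using cell_vanishing[OF i True] by blast
    next
      case False
      then have "0 < ell i p" using sgn_cellD[OF p i] s by (auto simp: sgn_if split: if_splits)
      then have "valid p i s" using s pl i by (simp add: valid_def)
      then show ?thesis by blast
    qed
  qed
qed

lemma finite_cells: "finite cells"
proof -
  let ?T = "{-1, 0, 1 :: real}"
  let ?y = "\<lambda>(u0, u1, u2) p. sgn (ell 0 p) = (u0::real) \<and> sgn (ell 1 p) = (u1::real) \<and> sgn (ell 2 p)
    = (u2::real)"
  \<comment> \<open>A cell depends on x only through three signs, so one chosen point for each sign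
    vector represents all cells.\<close>
  let ?f = "\<lambda>(u, i, s). cell (SOME x. ?y u x) i s"
  have "cells \<subseteq> ?f ` ((?T \<times> ?T \<times> ?T) \<times> {..<3} \<times> ?T)"
  proof
    fix \<sigma> assume "\<sigma> \<in> cells"
    then obtain x i s where \<sigma>: "\<sigma> = cell x i s" "valid x i s" by (auto simp: cells_def)
    let ?u = "(sgn (ell 0 x), sgn (ell 1 x), sgn (ell 2 x))"
    have "?y ?u (SOME x'. ?y ?u x')" by (rule someI[of _ x]) simp
    then have "cell x i s = ?f (?u, i, s)"
      unfolding cell_def by (auto simp: less_3_cases intro!: sign_cell_cong)
    moreover have "(?u, i, s) \<in> (?T \<times> ?T \<times> ?T) \<times> {..<3} \<times> ?T"
      using \<sigma>(2) by (auto simp: valid_def sgn_if abs_if split: if_splits)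
    ultimately show "\<sigma> \<in> ?f ` ((?T \<times> ?T \<times> ?T) \<times> {..<3} \<times> ?T)" using \<sigma>(1) by blast
  qed
  then show ?thesis by (rule finite_subset) auto
qed

lemma face_in_cells:
  assumes "\<sigma> \<in> cells" "\<tau> face_of \<sigma>" "\<tau> \<noteq> {}"
  shows "\<tau> \<in> cells"
proof -
  obtain x i s where \<sigma>: "\<sigma> = cell x i s" "valid x i s" using assms(1) by (auto simp: cells_def)
  obtain y where y: "y \<in> \<tau>" "\<tau> = cell y i s"
    using face_of_sign_cell[of "{..<3}" ell "lift i s" \<tau> x] assms \<sigma>(1) linear_ell subspace_lift
    unfolding cell_def by auto
  then have "y \<in> cell x i s" using assms(2) \<sigma>(1) face_of_imp_subset by blast
  then obtain i' s' where "valid y i' s'" "cell y i s = cell y i' s'"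
    using valid_in_cell[OF \<sigma>(2)] by blast
  then show ?thesis using y(2) unfolding cells_def by blast
qed

lemma lift_Int_lift:
  assumes "i < 3" "i' < 3"
  obtains J where "J \<subseteq> {..<3}" "lift i s \<inter> lift i' s' = {p \<in> lift i s. \<forall>j\<in>J. ell j p = 0}"
proof -
  \<comment> \<open>Two graphs in the same direction with different slopes meet where their form
    vanishes. In independent directions equal fibre values are both 0, so the form of each sheet
    with nonzero slope vanishes.\<close>
  define J where "J = (if i = i' \<and> s = s' \<or> s = 0 \<and> s' = 0 then {} else if s = 0 then {i'}
    else if s' = 0 then {i} else {i, i'})"
  have "(p \<in> lift i s \<and> p \<in> lift i' s') = (p \<in> lift i s \<and> (\<forall>j\<in>J. ell j p = 0))" for p
  proof (cases "i = i'")
    case True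
    have "s * ell i p = s' * ell i p \<longleftrightarrow> s = s' \<or> ell i p = 0" by auto
    then show ?thesis using True unfolding J_def lift_def by auto
  next
    case False
    have "s * ell i p = 0" "s' * ell i' p = 0" if "(s * ell i p) *\<^sub>R cvec i = (s' * ell i' p) *\<^sub>R cvec i'"
      using cvec_independent[OF assms False that] by auto
    then show ?thesis using False unfolding J_def lift_def by auto
  qed
  then have "lift i s \<inter> lift i' s' = {p \<in> lift i s. \<forall>j\<in>J. ell j p = 0}" by blast
  moreover have "J \<subseteq> {..<3}" using assms by (auto simp: J_def)
  ultimately show thesis using that by blast
qed

text \<open>A form whose signs at x and x' differ must vanish on the intersection. Together with the
  forms that describe the intersection of the two sheets, this exhibits the intersection as a
  vanishing locus in the first cell, hence as a face.\<close>

lemma cells_Int_face: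
  assumes "i < 3" "i' < 3"
  shows "(cell x i s \<inter> cell x' i' s') face_of cell x i s"
proof -
  obtain J where J: "J \<subseteq> {..<3}" "lift i s \<inter> lift i' s' = {p \<in> lift i s. \<forall>j\<in>J. ell j p = 0}"
    using lift_Int_lift[OF assms] .
  define I where "I = J \<union> {j\<in>{..<3}. sgn (ell j x) \<noteq> sgn (ell j x')}"
  have "cell x i s \<inter> cell x' i' s' = {p \<in> cell x i s. \<forall>j\<in>I. ell j p = 0}"
  proof (intro equalityI subsetI)
    fix p assume p: "p \<in> cell x i s \<inter> cell x' i' s'"
    then have "p \<in> lift i s \<inter> lift i' s'" by (simp add: cell_def sign_cell_def)
    then have "\<forall>j\<in>J. ell j p = 0" unfolding J(2) by simp
    moreover have "ell j p = 0" if "j < 3" "sgn (ell j x) \<noteq> sgn (ell j x')" for j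
      using sgn_cellD[of p x i s j] sgn_cellD[of p x' i' s' j] that p by auto
    ultimately show "p \<in> {p \<in> cell x i s. \<forall>j\<in>I. ell j p = 0}" using p by (auto simp: I_def)
  next
    fix p assume p: "p \<in> {p \<in> cell x i s. \<forall>j\<in>I. ell j p = 0}"
    then have "p \<in> {p \<in> lift i s. \<forall>j\<in>J. ell j p = 0}" by (simp add: I_def cell_def sign_cell_def)
    then have l: "p \<in> lift i' s'" using J(2) by blast
    have "0 \<le> sgn (ell j x') * ell j p \<and> (ell j x' = 0 \<longrightarrow> ell j p = 0)" if "j < 3" for j
    proof (cases "sgn (ell j x) = sgn (ell j x')")
      case True
      have "0 \<le> sgn (ell j x) * ell j p \<and> (sgn (ell j x) = 0 \<longrightarrow> ell j p = 0)"
        using p that by (simp add: cell_def sign_cell_def sgn_0_0)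
      then show ?thesis unfolding True by (simp add: sgn_0_0)
    next
      case False
      then have "ell j p = 0" using p that unfolding I_def by blast
      then show ?thesis by simp
    qed
    then show "p \<in> cell x i s \<inter> cell x' i' s'" using p l by (simp add: cell_def sign_cell_def)
  qed
  also have "\<dots> face_of cell x i s"
    unfolding cell_def using J(1) linear_ell subspace_lift
    by (intro sign_cell_vanishing_face) (auto simp: I_def)
  finally show ?thesis .
qed

lemma rational_cell:
  assumes "s \<in> \<rat>"
  shows "rational_polyhedron (cell x i s)"
proof -
  define v where "v j = (if j = 0 then axis a 1 else if j
    = 1 then axis b 1 else - axis a 1 - axis b 1 :: real^'n)" for j :: nat
  have v: "ell j p = v j \<bullet> p" for j p
    by (auto simp: ell_def v_def inner_axis' inner_diff_left inner_minus_left)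
  have vr: "v j $ i \<in> \<rat>" for j i by (auto simp: v_def axis_def)
  have cr: "cvec j $ i \<in> \<rat>" for j i by (auto simp: cvec_def axis_def)
  have "rational_polyhedron {p. 0 \<le> sgn (ell j x) * ell j p \<and> (ell j x = 0 \<longrightarrow> ell j p = 0)}" for j
  proof (cases "ell j x = 0")
    case True
    have "rational_polyhedron {p. v j \<bullet> p = 0}" using vr by (rule rational_polyhedron_hyperplane)
    then show ?thesis using True by (simp add: v)
  next
    case False
    have "rational_polyhedron {p. (- sgn (ell j x) *\<^sub>R v j) \<bullet> p \<le> 0}"
      using vr by (intro rational_polyhedron_halfspace) (auto simp: sgn_if)
    then show ?thesis using False by (simp add: v)
  qed
  \<comment> \<open>The sheet is cut out by one such equation for each coordinate outside K;
    rationality of s makes the normals rational.\<close>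
  moreover have "rational_polyhedron {p. p $ l = (s * ell i p) * cvec i $ l}" for l
  proof -
    have "rational_polyhedron {p. (axis l 1 - (s * cvec i $ l) *\<^sub>R v i) \<bullet> p = 0}"
      using vr cr assms by (intro rational_polyhedron_hyperplane) (auto simp: axis_def)
    moreover have "(axis l 1 - (s * cvec i $ l) *\<^sub>R v i) \<bullet> p = p $ l - (s * ell i p) * cvec i $ l" for p
      by (simp add: v inner_diff_left inner_axis')
    ultimately show ?thesis by simp
  qed
  moreover have "cell x i s = (\<Inter>j\<in>{..<3}. {p. 0 \<le> sgn (ell j x) * ell j p \<and> (ell j x = 0 \<longrightarrow> ell j p = 0)})
      \<inter> (\<Inter>l\<in>-K. {p. p $ l = (s * ell i p) * cvec i $ l})"
  proof -
    have "cvec i $ l = 0" if "l \<in> K" for l using that cd by (auto simp: cvec_def axis_def)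
    then have "p \<in> lift i s \<longleftrightarrow> (\<forall>l\<in>-K. p $ l = (s * ell i p) * cvec i $ l)" for p
      by (auto simp: lift_def fib_def vec_eq_iff)
    then show ?thesis by (auto simp: cell_def sign_cell_def)
  qed
  ultimately show ?thesis
    by (simp only:) (intro rational_polyhedron_Int rational_polyhedron_INT, auto)
qed

lemma rational_polyhedral_complex_cells: "rational_polyhedral_complex cells"
  unfolding rational_polyhedral_complex_def
proof (intro conjI ballI allI impI)
  fix \<sigma> assume "\<sigma> \<in> cells"
  then obtain x i s where \<sigma>: "\<sigma> = cell x i s" "valid x i s" by (auto simp: cells_def)
  have "s \<in> \<rat>" using \<sigma>(2) by (auto simp: valid_def abs_if split: if_splits)
  then show "rational_polyhedron \<sigma>" using rational_cell \<sigma>(1) by simp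
  show "\<sigma> \<noteq> {}" using valid_self[OF \<sigma>(2)] \<sigma>(1) by auto
next
  fix \<sigma> \<tau> assume "\<sigma> \<in> cells" "\<tau> face_of \<sigma> \<and> \<tau> \<noteq> {}"
  then show "\<tau> \<in> cells" using face_in_cells by blast
next
  fix \<sigma> \<sigma>' assume "\<sigma> \<in> cells" "\<sigma>' \<in> cells"
  then obtain x i s x' i' s' where "\<sigma> = cell x i s" "valid x i s" "\<sigma>' = cell x' i' s'" "valid x' i' s'"
    by (auto simp: cells_def)
  moreover from this have "cell x' i' s' \<inter> cell x i s face_of cell x' i' s'"
    "cell x i s \<inter> cell x' i' s' face_of cell x i s"
    using cells_Int_face by (simp_all add: valid_def)
  ultimately show "\<sigma> \<inter> \<sigma>' face_of \<sigma>" "\<sigma> \<inter> \<sigma>' face_of \<sigma>'"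
    by (simp_all add: Int_commute)
qed

text \<open>Integer base vectors with \<open>ell j (dvec j) = 1\<close>. They cross the wall
  \<open>ell j = 0\<close> towards its positive side, and their lifts serve as lattice
  normals.\<close>

definition dvec :: "nat \<Rightarrow> real^'n" where
  "dvec j = (if j = 0 then axis a 1 else if j = 1 then axis b 1 else - axis a 1)"

lemma ell_dvec [simp]: "ell j (dvec j) = 1"
  using ab by (auto simp: ell_def dvec_def axis_def)

lemma abs_ell_dvec: "\<bar>ell i (dvec j)\<bar> \<le> 1"
  using ab by (auto simp: ell_def dvec_def axis_def)

lemma fib_dvec [simp]: "fib (dvec j) = 0"
  using ab by (auto simp: fib_def dvec_def axis_def vec_eq_iff)

section \<open>Dimensions of the cells\<close>

lemma dim_lift: "dim (lift i s) = card K"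
proof -
  let ?B = "{p :: real^'n. \<forall>l. l \<notin> K \<longrightarrow> p $ l = 0}"
  have B: "p \<in> ?B \<longleftrightarrow> fib p = 0" for p by (auto simp: fib_def vec_eq_iff)
  \<comment> \<open>Removing the fibre part inverts the lifting on the base, so the sheet is
    isomorphic to the coordinate subspace of K.\<close>
  have inj: "inj_on (lifted i s) ?B"
  proof (rule inj_on_inverseI)
    fix p assume "p \<in> ?B"
    then show "lifted i s p - fib (lifted i s p) = p"
      unfolding B by (simp add: lifted_def fib_add fib_diff fib_scale)
  qed
  have "lifted i s ` ?B = lift i s"
  proof (intro equalityI subsetI)
    fix q assume q: "q \<in> lift i s"
    have "fib (q - fib q) = 0" "ell i (q - fib q) = ell i q" by (simp_all add: fib_diff ell_diff)
    then have "q = lifted i s (q - fib q)" using q unfolding lifted_def lift_def by simp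
    moreover have "q - fib q \<in> ?B" unfolding B by (simp add: fib_diff)
    ultimately show "q \<in> lifted i s ` ?B" by blast
  qed (use lifted_in_lift in auto)
  moreover have "dim (lifted i s ` ?B) = dim ?B"
    using inj by (intro dim_image_eq[OF linear_lifted]) (simp add: subspace_coordinates
      span_eq_iff[THEN iffD2])
  ultimately show ?thesis by (simp add: dim_coordinates)
qed

lemma affine_hull_cell:
  assumes "x \<in> lift i s"
  shows "affine hull (cell x i s) = {p \<in> lift i s. \<forall>j<3. ell j x = 0 \<longrightarrow> ell j p = 0}"
  using affine_hull_sign_cell[of "{..<3}" ell "lift i s" x] linear_ell subspace_lift assms
  by (simp add: cell_def Ball_def)

text \<open>The three forms sum to 0. Consequently none, exactly one or all of them vanish at a
  point, which gives cells of codimension 0, 1 or 2.\<close>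

lemma ell_two_zeros:
  assumes "j < 3" "j' < 3" "j \<noteq> j'" "ell j x = 0" "ell j' x = 0" "j'' < 3"
  shows "ell j'' x = 0"
  using assms ell_sum[of x] unfolding less_3_cases by auto

lemma affine_hull_cell_full:
  assumes "x \<in> lift i s" "\<And>j. j < 3 \<Longrightarrow> ell j x \<noteq> 0"
  shows "affine hull (cell x i s) = lift i s"
  using affine_hull_cell[OF assms(1)] assms(2) by auto

lemma affine_hull_cell_facet:
  assumes "x \<in> lift i s" "j < 3" "ell j x = 0" "j' < 3" "ell j' x \<noteq> 0"
  shows "affine hull (cell x i s) = {p \<in> lift i s. ell j p = 0}"
proof -
  have "ell l x \<noteq> 0" if "l < 3" "l \<noteq> j" for l
    using ell_two_zeros[of j l x j'] assms that by auto
  then show ?thesis using affine_hull_cell[OF assms(1)] assms by auto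
qed

lemma subspace_lift_facet: "subspace {p \<in> lift i s. ell j p = 0}"
proof -
  have "{p \<in> lift i s. ell j p = 0} = lift i s \<inter> {p. ell j p = 0}" by auto
  then show ?thesis
    by (simp only:) (intro subspace_inter subspace_lift linear_subspace_kernel linear_ell)
qed

lemma dim_lift_facet: "dim {p \<in> lift i s. ell j p = 0} + 1 = card K"
  using dim_kernel_section[OF subspace_lift linear_ell lifted_in_lift[of i s "dvec j"], of j]
  by (simp add: dim_lift)

lemma aff_dim_eq_dim:
  assumes "affine hull S = W" "subspace W"
  shows "aff_dim S = int (dim W)"
  by (metis assms aff_dim_affine_hull aff_dim_subspace)

lemma aff_dim_cell_full:
  assumes "x \<in> lift i s" "\<And>j. j < 3 \<Longrightarrow> ell j x \<noteq> 0"
  shows "aff_dim (cell x i s) = int (card K)"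
  using aff_dim_eq_dim[OF affine_hull_cell_full[OF assms] subspace_lift] by (simp add: dim_lift)

lemma aff_dim_cell_facet:
  assumes "x \<in> lift i s" "j < 3" "ell j x = 0" "j' < 3" "ell j' x \<noteq> 0"
  shows "aff_dim (cell x i s) = int (card K) - 1"
  using aff_dim_eq_dim[OF affine_hull_cell_facet[OF assms] subspace_lift_facet] dim_lift_facet[of i s j]
  by simp

lemma aff_dim_cell_origin:
  assumes "x \<in> lift i s" "\<And>j. j < 3 \<Longrightarrow> ell j x = 0"
  shows "aff_dim (cell x i s) = int (card K) - 2"
proof -
  let ?W = "{p \<in> lift i s. ell 0 p = 0}"
  have eq: "{p \<in> lift i s. \<forall>j<3. ell j x = 0 \<longrightarrow> ell j p = 0} = {p \<in> ?W. ell 1 p = 0}"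
  proof -
    have "(\<forall>j<3. ell j x = 0 \<longrightarrow> ell j p = 0) \<longleftrightarrow> ell 0 p = 0 \<and> ell 1 p = 0" for p
      using assms(2) ell_sum[of p] by (auto simp: less_3_cases)
    then show ?thesis by auto
  qed
  \<comment> \<open>This vector satisfies the first equation but not the second, so the second one
    lowers the dimension again; the third equation follows from these two.\<close>
  have "lifted i s (dvec 1) \<in> ?W"
  proof -
    have "ell 0 (dvec 1) = 0" using ab by (simp add: ell_def dvec_def axis_def)
    then show ?thesis using lifted_in_lift by simp
  qed
  then have "dim {p \<in> ?W. ell 1 p = 0} + 1 = dim ?W"
    by (intro dim_kernel_section[OF subspace_lift_facet linear_ell]) auto
  moreover have "subspace {p \<in> ?W. ell 1 p = 0}"
  proof -
    have "{p \<in> ?W. ell 1 p = 0} = ?W \<inter> {p. ell 1 p = 0}" by auto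
    then show ?thesis
      by (simp only:) (intro subspace_inter subspace_lift_facet linear_subspace_kernel linear_ell)
  qed
  ultimately show ?thesis
    using aff_dim_eq_dim[OF affine_hull_cell[OF assms(1), unfolded eq]] dim_lift_facet[of i s 0] by simp
qed

lemma cell_dim_cases:
  assumes "x \<in> lift i s"
  shows "aff_dim (cell x i s) = int (card K) \<longleftrightarrow> (\<forall>j<3. ell j x \<noteq> 0)"
    and "aff_dim (cell x i s) = int (card K) - 1 \<longleftrightarrow> (\<exists>j<3. ell j x = 0) \<and> (\<exists>j<3. ell j x \<noteq> 0)"
proof -
  consider "\<forall>j<3. ell j x \<noteq> 0" | "\<exists>j<3. ell j x = 0" "\<exists>j<3. ell j x \<noteq> 0" | "\<forall>j<3. ell j x = 0"
    by blast
  then have "(aff_dim (cell x i s) = int (card K) \<longleftrightarrow> (\<forall>j<3. ell j x \<noteq> 0)) \<and>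
    (aff_dim (cell x i s) = int (card K) - 1 \<longleftrightarrow> (\<exists>j<3. ell j x = 0) \<and> (\<exists>j<3. ell j x \<noteq> 0))"
  proof cases
    case 1
    then have "aff_dim (cell x i s) = int (card K)" using aff_dim_cell_full[OF assms] by blast
    then show ?thesis using 1 by auto
  next
    case 2
    then obtain j j' where "j < 3" "ell j x = 0" "j' < 3" "ell j' x \<noteq> 0" by blast
    then have "aff_dim (cell x i s) = int (card K) - 1" using aff_dim_cell_facet[OF assms] by blast
    then show ?thesis using 2 by auto
  next
    case 3
    have 0: "(0::nat) < 3" by simp
    have "aff_dim (cell x i s) = int (card K) - 2" using aff_dim_cell_origin[OF assms] 3 by blast
    moreover have "\<not> (\<forall>j<3. ell j x \<noteq> 0)" using 3 0 by blast
    ultimately show ?thesis using 3 by auto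
  qed
  then show "aff_dim (cell x i s) = int (card K) \<longleftrightarrow> (\<forall>j<3. ell j x \<noteq> 0)"
    and "aff_dim (cell x i s) = int (card K) - 1 \<longleftrightarrow> (\<exists>j<3. ell j x = 0) \<and> (\<exists>j<3. ell j x \<noteq> 0)"
    by blast+
qed

section \<open>Perturbation off a wall, and purity\<close>

lemma ell_perturb: "ell j (x + r *\<^sub>R lifted i s (dvec j)) = ell j x + r"
  by (simp add: ell_add ell_scale)

text \<open>Where \<open>ell j\<close> vanishes, the other two forms are opposite with a common
  nonzero absolute value. Half of it is a safe step length, as the forms are at most 1 in absolute
  value on \<open>dvec j\<close>; one length serves both sides of the wall and all sheets.\<close>

lemma perturb:
  assumes j: "j < 3" "ell j x = 0" and nz: "\<exists>j'<3. ell j' x \<noteq> 0"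
  obtains \<delta> where "\<delta> > 0"
    "\<forall>r j' i s. \<bar>r\<bar> = \<delta> \<and> j' < 3 \<and> j' \<noteq> j \<longrightarrow> sgn (ell j' (x + r *\<^sub>R lifted i s (dvec j))) = sgn (ell j' x)"
proof -
  obtain k where k: "k < 3" "ell k x \<noteq> 0" using nz by blast
  have abs: "\<bar>ell j' x\<bar> = \<bar>ell k x\<bar>" if "j' < 3" "j' \<noteq> j" for j'
    using that k j ell_sum[of x] unfolding less_3_cases by (elim disjE) auto
  show thesis
  proof
    show "\<bar>ell k x\<bar> / 2 > 0" using k by simp
    show "\<forall>r j' i s. \<bar>r\<bar> = \<bar>ell k x\<bar> / 2 \<and> j' < 3 \<and> j' \<noteq> j
        \<longrightarrow> sgn (ell j' (x + r *\<^sub>R lifted i s (dvec j))) = sgn (ell j' x)"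
    proof (intro allI impI, elim conjE)
      fix r j' i s assume r: "\<bar>r\<bar> = \<bar>ell k x\<bar> / 2" and j': "j' < 3" "j' \<noteq> j"
      have "\<bar>r * ell j' (dvec j)\<bar> \<le> \<bar>r\<bar> * 1"
        unfolding abs_mult using abs_ell_dvec by (intro mult_left_mono) auto
      then have "\<bar>r * ell j' (dvec j)\<bar> < \<bar>ell j' x\<bar>" using r k abs[OF j'] by simp
      moreover have "ell j' (x + r *\<^sub>R lifted i s (dvec j)) = ell j' x + r * ell j' (dvec j)"
        by (simp add: ell_add ell_scale)
      ultimately show "sgn (ell j' (x + r *\<^sub>R lifted i s (dvec j))) = sgn (ell j' x)"
        by (auto simp: sgn_if)
    qed
  qed
qed

lemma cell_mono:
  assumes "\<And>j. j < 3 \<Longrightarrow> ell j x = 0 \<or> sgn (ell j x) = sgn (ell j y)"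
  shows "cell x i s \<subseteq> cell y i s"
  unfolding cell_def using assms by (intro sign_cell_mono) auto

lemma cell_cong:
  assumes "\<And>j. j < 3 \<Longrightarrow> sgn (ell j x) = sgn (ell j y)"
  shows "cell x i s = cell y i s"
  unfolding cell_def using assms by (intro sign_cell_cong) auto

text \<open>Every valid cell is contained in a valid cell on the same sheet at whose representing
  point no form vanishes. By maximality the two coincide.\<close>

lemma pure_dimensional_cells: "pure_dimensional (card K) cells"
  unfolding pure_dimensional_def
proof (intro ballI impI)
  fix \<sigma> assume "\<sigma> \<in> cells" and max: "\<forall>\<sigma>'\<in>cells. \<sigma> \<subseteq> \<sigma>' \<longrightarrow> \<sigma>' = \<sigma>"
  then obtain x i s where \<sigma>: "\<sigma> = cell x i s" and v: "valid x i s" by (auto simp: cells_def)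
  have "\<exists>y. valid y i s \<and> cell x i s \<subseteq> cell y i s \<and> (\<forall>j<3. ell j y \<noteq> 0)"
  proof -
    consider "\<forall>j<3. ell j x \<noteq> 0" | "\<exists>j<3. ell j x = 0" "\<exists>j<3. ell j x \<noteq> 0" | "\<forall>j<3. ell j x = 0"
      by blast
    then show ?thesis
    proof cases
      case 1
      then show ?thesis using v by blast
    next
      case 2
      then obtain j where j: "j < 3" "ell j x = 0" by blast
      obtain \<delta> where \<delta>: "\<delta> > 0"
        "\<forall>r j' i s. \<bar>r\<bar> = \<delta> \<and> j' < 3 \<and> j' \<noteq> j \<longrightarrow> sgn (ell j' (x + r *\<^sub>R lifted i s (dvec j))) = sgn (ell j' x)"
        using perturb[OF j 2(2)] .
      \<comment> \<open>The step goes to the negative side of the wall, so that the set of positive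
        forms, and with it validity, is unchanged.\<close>
      define y where "y = x + (- \<delta>) *\<^sub>R lifted i s (dvec j)"
      have sg: "sgn (ell j' y) = sgn (ell j' x)" if "j' < 3" "j' \<noteq> j" for j'
        unfolding y_def using \<delta>(2)[rule_format, of "- \<delta>" j' i s] \<delta>(1) that by simp
      have neg: "ell j y = - \<delta>" unfolding y_def ell_perturb using j by simp
      have nz: "ell j' x \<noteq> 0" if "j' < 3" "j' \<noteq> j" for j'
        using ell_two_zeros[of j j' x] j 2(2) that by blast
      have nzy: "ell j' y \<noteq> 0" if "j' < 3" for j'
        using sg[OF that] neg \<delta>(1) nz[OF that] by (cases "j' = j") (auto simp: sgn_0_0)
      have pos: "0 < ell j' y \<longleftrightarrow> 0 < ell j' x" if "j' < 3" for j'
        using sg[OF that] neg \<delta>(1) j by (cases "j' = j") (auto simp: sgn_if split: if_splits)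
      have "y \<in> lift i s" unfolding y_def
        using v lifted_in_lift by (intro subspace_add[OF subspace_lift] subspace_scale[OF
          subspace_lift]) (auto simp: valid_def)
      then have "valid y i s" using v pos unfolding valid_def few_positive_def by blast
      moreover have "cell x i s \<subseteq> cell y i s" using sg j by (intro cell_mono) metis
      ultimately show ?thesis using nzy by blast
    next
      case 3
      \<comment> \<open>The forms take the values 1, -1/2, -1/2 here, so the flat sheet is valid. At
        the origin of the base only the flat sheet occurs.\<close>
      define y where "y = axis a 1 - (1/2) *\<^sub>R axis b (1::real)"
      have y: "ell 0 y = 1" "ell 1 y = - 1/2" "ell 2 y = -1/2" "fib y = 0"
        using ab by (auto simp: y_def ell_def axis_def fib_def vec_eq_iff)
      have s: "s = 0" "i < 3" using v 3 by (auto simp: valid_def)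
      have "valid y i s" using s y by (auto simp: valid_def lift_def few_positive_def less_3_cases)
      moreover have "cell x i s \<subseteq> cell y i s" using 3 by (intro cell_mono) auto
      ultimately show ?thesis using y by (auto simp: less_3_cases)
    qed
  qed
  then obtain y where y: "valid y i s" "cell x i s \<subseteq> cell y i s" "\<forall>j<3. ell j y \<noteq> 0" by blast
  have "cell y i s \<in> cells" using y(1) by (auto simp: cells_def)
  then have "\<sigma> = cell y i s" using max y(2) \<sigma> by auto
  then show "aff_dim \<sigma> = int (card K)" using cell_dim_cases(1)[of y i s] y by (simp add: valid_def)
qed

text \<open>Weights are functions of sets, so the flatness of a cell is read off from the vanishing
  of the fibre component on it.\<close>

definition weight :: "(real^'n) set \<Rightarrow> real" where
  "weight \<sigma> = (if \<sigma> \<subseteq> {p. fib p = 0} then 2 else 1)"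

section \<open>Lattice normals and the balancing condition\<close>

lemma ell_integer: "p \<in> integer_lattice \<Longrightarrow> ell j p \<in> \<int>"
  by (auto simp: ell_def integer_lattice_def)

lemma lifted_dvec_integer:
  assumes "s \<in> \<int>"
  shows "lifted i s (dvec j) \<in> integer_lattice"
proof -
  have "ell i (dvec j) \<in> \<int>" by (intro ell_integer) (auto simp: integer_lattice_def dvec_def axis_def)
  moreover have "dvec j $ l \<in> \<int>" "cvec i $ l \<in> \<int>" for l by (auto simp: dvec_def cvec_def axis_def)
  ultimately show ?thesis using assms by (auto simp: integer_lattice_def lifted_def)
qed

lemma integer_lattice_scale: "p \<in> integer_lattice \<Longrightarrow> r \<in> \<int> \<Longrightarrow> r *\<^sub>R p \<in> integer_lattice"
  by (auto simp: integer_lattice_def)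

lemma integer_lattice_add: "p \<in> integer_lattice \<Longrightarrow> q \<in> integer_lattice \<Longrightarrow> p + q \<in> integer_lattice"
  by (auto simp: integer_lattice_def)

text \<open>On integer vectors \<open>ell j\<close> has integer values, and on the proposed normal
  it has the value r, which is 1 or -1. Subtracting a suitable integer multiple of the normal
  therefore moves any lattice vector of the sheet into the wall.\<close>

lemma lattice_normal_cell:
  assumes x: "x \<in> lift i s" "j < 3" "ell j x = 0" "j' < 3" "ell j' x \<noteq> 0" and s: "s \<in> \<int>"
    and r: "\<bar>r\<bar> = 1" "\<delta> > 0"
    and y: "y = x + (r * \<delta>) *\<^sub>R lifted i s (dvec j)" "\<And>l. l < 3 \<Longrightarrow> ell l y \<noteq> 0"
  shows "lattice_normal (cell y i s) (cell x i s) (r *\<^sub>R lifted i s (dvec j))"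
proof -
  let ?u = "r *\<^sub>R lifted i s (dvec j)"
  have yl: "y \<in> lift i s"
    unfolding y(1) using x lifted_in_lift by (intro subspace_add[OF subspace_lift] subspace_scale[OF
      subspace_lift])
  have rr: "r * r = 1" "r \<in> \<int>" using r(1) by (auto simp: abs_if split: if_splits)
  have D\<sigma>: "direction_lattice (cell y i s) = lift i s \<inter> integer_lattice"
    using direction_space_affine_hull_subspace[OF affine_hull_cell_full[OF yl y(2)] subspace_lift]
    by (simp add: direction_lattice_def)
  have D\<tau>: "direction_lattice (cell x i s) = {p \<in> lift i s. ell j p = 0} \<inter> integer_lattice"
    using direction_space_affine_hull_subspace[OF affine_hull_cell_facet[OF x] subspace_lift_facet]
    by (simp add: direction_lattice_def)
  have u: "?u \<in> lift i s \<inter> integer_lattice"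
    using lifted_in_lift lifted_dvec_integer[OF s] rr by
      (auto intro!: subspace_scale[OF subspace_lift] integer_lattice_scale)
  have eu: "ell j ?u = r" by (simp add: ell_scale)
  have "lift i s \<inter> integer_lattice = {v + of_int k *\<^sub>R ?u | v k. v \<in> {p \<in> lift i s. ell j p
    = 0} \<inter> integer_lattice}"
  proof (intro equalityI subsetI)
    fix p assume p: "p \<in> lift i s \<inter> integer_lattice"
    then have "r * ell j p \<in> \<int>" using ell_integer rr by auto
    then obtain k where k: "r * ell j p = of_int k" by (elim Ints_cases)
    have "ell j (p - of_int k *\<^sub>R ?u) = ell j p - (r * ell j p) * r"
      unfolding ell_diff ell_scale eu k[symmetric] by simp
    also have "\<dots> = 0" using rr(1) by (simp add: algebra_simps)
    finally have "p - of_int k *\<^sub>R ?u \<in> {p \<in> lift i s. ell j p = 0} \<inter> integer_lattice"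
      using p u by (auto intro!: subspace_diff[OF subspace_lift] subspace_scale[OF subspace_lift]
          integer_lattice_diff integer_lattice_scale simp del: scaleR_scaleR)
    moreover have "p = (p - of_int k *\<^sub>R ?u) + of_int k *\<^sub>R ?u" by simp
    ultimately show "p \<in> {v + of_int k *\<^sub>R ?u | v k. v \<in> {p \<in> lift i s. ell j p
      = 0} \<inter> integer_lattice}" by blast
  next
    fix p assume "p \<in> {v + of_int k *\<^sub>R ?u | v k. v \<in> {p \<in> lift i s. ell j p = 0} \<inter> integer_lattice}"
    then obtain v k where v: "p = v + of_int k *\<^sub>R ?u" "v \<in> lift i s" "v \<in> integer_lattice" by blast
    show "p \<in> lift i s \<inter> integer_lattice"
      unfolding v(1) using v(2,3) lifted_in_lift lifted_dvec_integer[OF s] rr(2)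
        by (intro IntI subspace_add[OF subspace_lift] subspace_scale[OF subspace_lift]
          integer_lattice_add integer_lattice_scale) auto
  qed
  moreover have "x \<in> cell x i s" "y \<in> cell y i s"
    using x(1) yl by (simp_all add: cell_def sign_cell_self)
  moreover have "x + \<delta> *\<^sub>R ?u = y" using y(1) by (simp add: mult.commute)
  ultimately show ?thesis
    unfolding lattice_normal_def D\<sigma> D\<tau> using u r(2) by auto
qed

text \<open>On a cell of codimension one exactly one form \<open>ell j\<close> vanishes. Inside a
  half-sheet its neighbours are the two continuations across the wall, with opposite normals and
  weight 1. On the flat sheet they are one flat sector of weight 2 on the negative side and two
  half-sheet cells of weight 1 on the positive side.\<close>

lemma balanced_cells: "balanced (card K) cells weight"
  unfolding balanced_def
proof (intro ballI impI)
  fix \<tau> assume \<tau>C: "\<tau> \<in> cells" and dim: "aff_dim \<tau> = int (card K) - 1"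
  then obtain x i s where \<tau>: "\<tau> = cell x i s" and v: "valid x i s" by (auto simp: cells_def)
  have xl: "x \<in> lift i s" and i: "i < 3" using v by (auto simp: valid_def)
  have nz: "\<exists>j<3. ell j x \<noteq> 0" and "\<exists>j<3. ell j x = 0" using dim cell_dim_cases(2)[OF xl] \<tau> by auto
  then obtain j where j: "j < 3" "ell j x = 0" by blast
  have nzj: "ell l x \<noteq> 0" if "l < 3" "l \<noteq> j" for l
    using ell_two_zeros[of j l x] j nz that by blast
  obtain l0 where l0: "l0 < 3" "ell l0 x \<noteq> 0" using nz by blast
  obtain \<delta> where \<delta>: "\<delta> > 0"
    "\<forall>r j' i s. \<bar>r\<bar> = \<delta> \<and> j' < 3 \<and> j' \<noteq> j \<longrightarrow> sgn (ell j' (x + r *\<^sub>R lifted i s (dvec j))) = sgn (ell j' x)"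
    using perturb[OF j nz] .
  \<comment> \<open>For r = 1 and r = -1 these points lie near x on the two sides of the wall; they
    represent all candidates for neighbours of \<tau>.\<close>
  define y where "y r i s = x + (r * \<delta>) *\<^sub>R lifted i s (dvec j)" for r i s
  have sgy: "sgn (ell l (y r i s)) = sgn (ell l x)" if "\<bar>r\<bar> = 1" "l < 3" "l \<noteq> j" for r i s l
    unfolding y_def using \<delta>(2)[rule_format, of "r * \<delta>" l i s] \<delta>(1) that by (simp add: abs_mult)
  have ejy: "ell j (y r i s) = r * \<delta>" for r i s unfolding y_def ell_perturb using j by simp
  have nzy: "ell l (y r i s) \<noteq> 0" if "\<bar>r\<bar> = 1" "l < 3" for r i s l
    using sgy[OF that, of i s] ejy nzj[OF that(2)] that(1) \<delta>(1) by (cases "l = j") (auto simp: sgn_0_0)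
  have posy: "0 < ell l (y r i s) \<longleftrightarrow> 0 < ell l x" if "\<bar>r\<bar> = 1" "l < 3" "l \<noteq> j" for r i s l
    using sgy[OF that, of i s] by (auto simp: sgn_if split: if_splits)
  have yl: "y r i s \<in> lift i s" if "x \<in> lift i s" for r i s
    unfolding y_def using that lifted_in_lift by (intro subspace_add[OF subspace_lift]
      subspace_scale[OF subspace_lift])
  have normal: "lattice_normal (cell (y r i' s') i' s') (cell x i' s') (r *\<^sub>R lifted i' s' (dvec j))"
    if "x \<in> lift i' s'" "s' \<in> \<int>" "\<bar>r\<bar> = 1" for r i' s'
    using that nzy by (intro lattice_normal_cell[OF that(1) j l0 that(2,3) \<delta>(1)]) (auto simp: y_def)
  have sub: "cell x i' s' \<subseteq> cell (y r i' s') i' s'" if "\<bar>r\<bar> = 1" for r i' s'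
    using sgy[OF that] j by (intro cell_mono) metis
  have yself: "y r i' s' \<in> cell (y r i' s') i' s'" if "x \<in> lift i' s'" for r i' s'
    using yl[OF that] by (simp add: cell_def sign_cell_self)
  let ?A = "{\<sigma> \<in> cells. aff_dim \<sigma> = int (card K) \<and> \<tau> face_of \<sigma>}"
  have mem: "cell (y r i' s') i' s' \<in> ?A"
    if "valid (y r i' s') i' s'" "x \<in> lift i' s'" "cell x i' s' = \<tau>" "\<bar>r\<bar> = 1" for r i' s'
  proof -
    have "cell (y r i' s') i' s' \<in> cells" using that(1) by (auto simp: cells_def)
    moreover have "aff_dim (cell (y r i' s') i' s') = int (card K)"
      using nzy[OF that(4)] yl[OF that(2)] by (intro aff_dim_cell_full) auto
    moreover have "\<tau> \<inter> cell (y r i' s') i' s' = \<tau>" using sub[OF that(4), of i' s'] that(3) by blast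
    moreover have "\<tau> \<inter> cell (y r i' s') i' s' face_of cell (y r i' s') i' s'"
      using rational_polyhedral_complex_cells calculation(1) \<tau>C
        unfolding rational_polyhedral_complex_def by blast
    ultimately show ?thesis by simp
  qed
  \<comment> \<open>Any neighbour of \<tau> lies on a sheet through x and agrees with x in the signs
    of the two other forms; only its sheet and the sign of \<open>ell j\<close> remain free.\<close>
  have memD: "\<exists>z i' s'. \<sigma> = cell z i' s' \<and> valid z i' s' \<and> ell j z \<noteq> 0 \<and> fib x = (s' * ell i' x) *\<^sub>R cvec i' \<and>
      (\<forall>l<3. l \<noteq> j \<longrightarrow> sgn (ell l z) = sgn (ell l x))" if \<sigma>A: "\<sigma> \<in> ?A" for \<sigma>
  proof -
    obtain z i' s' where z: "\<sigma> = cell z i' s'" "valid z i' s'" using \<sigma>A by (auto simp: cells_def)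
    have zl: "z \<in> lift i' s'" using z(2) by (simp add: valid_def)
    have "aff_dim (cell z i' s') = int (card K)" using \<sigma>A z(1) by simp
    then have "\<forall>l<3. ell l z \<noteq> 0" using cell_dim_cases(1)[OF zl] by blast
    moreover have "\<tau> \<subseteq> \<sigma>" using \<sigma>A face_of_imp_subset[of \<tau> \<sigma>] by simp
    then have xc: "x \<in> cell z i' s'" using valid_self[OF v] \<tau> z(1) by auto
    moreover have "sgn (ell l z) = sgn (ell l x)" if "l < 3" "l \<noteq> j" for l
      using sgn_cellD[OF xc that(1)] nzj[OF that] by auto
    moreover have "fib x = (s' * ell i' x) *\<^sub>R cvec i'" using xc
      by (simp add: cell_def sign_cell_def lift_def)
    ultimately show ?thesis using z j(1) by blast
  qed
  have cong: "cell z i' s' = cell (y r i' s') i' s'"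
    if "\<forall>l<3. l \<noteq> j \<longrightarrow> sgn (ell l z) = sgn (ell l x)" "sgn (ell j z) = r" "\<bar>r\<bar> = 1" for z i' s' r
  proof (rule cell_cong)
    fix l :: nat assume l: "l < 3"
    have "sgn (r * \<delta>) = r" using that(3) \<delta>(1) by (auto simp: sgn_mult abs_if sgn_if split: if_splits)
    then show "sgn (ell l z) = sgn (ell l (y r i' s'))"
      using that sgy[OF that(3) l, of i' s'] ejy l by (cases "l = j") auto
  qed
  show "\<exists>u. (\<forall>\<sigma>\<in>cells. aff_dim \<sigma> = int (card K) \<and> \<tau> face_of \<sigma> \<longrightarrow> lattice_normal \<sigma> \<tau> (u \<sigma>)) \<and>
     (\<Sum>\<sigma> | \<sigma> \<in> cells \<and> aff_dim \<sigma> = int (card K) \<and> \<tau> face_of \<sigma>. weight \<sigma> *\<^sub>R u \<sigma>) \<in> span (direction_lattice \<tau>)"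
  proof (cases "s = 0")
    case False
    then have s: "\<bar>s\<bar> = 1" "0 < ell i x" "s \<in> \<int>" using v by (auto simp: valid_def abs_if split: if_splits)
    have ij: "i \<noteq> j" using s j by auto
    define P N where "P = cell (y 1 i s) i s" and "N = cell (y (-1) i s) i s"
    have fx: "fib x = (s * ell i x) *\<^sub>R cvec i" using xl by (simp add: lift_def)
    have val: "valid (y r i s) i s" if "\<bar>r\<bar> = 1" for r
      using s i yl[OF xl] posy[OF that i ij] by (simp add: valid_def)
    have A: "?A = {P, N}"
    proof (intro equalityI subsetI)
      fix \<sigma> assume "\<sigma> \<in> ?A"
      then obtain z i' s' where z: "\<sigma> = cell z i' s'" "valid z i' s'" "ell j z \<noteq> 0" "fib x
        = (s' * ell i' x) *\<^sub>R cvec i'"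
        "\<forall>l<3. l \<noteq> j \<longrightarrow> sgn (ell l z) = sgn (ell l x)" using memD by blast
      have "i' < 3" using z(2) by (simp add: valid_def)
      have eq: "(s * ell i x) *\<^sub>R cvec i = (s' * ell i' x) *\<^sub>R cvec i'" using fx z(4) by simp
      \<comment> \<open>The fibre component of x is nonzero, so it determines both the direction and
        the slope of a sheet through x.\<close>
      have "i' = i" using cvec_independent(1)[OF i \<open>i' < 3\<close> _ eq] s by (cases "i = i'") auto
      then have "s' = s" using eq s by auto
      have "sgn (ell j z) = 1 \<or> sgn (ell j z) = -1" using z(3) by (auto simp: sgn_if)
      then show "\<sigma> \<in> {P, N}"
        using cong[OF z(5), of 1 i s] cong[OF z(5), of "-1" i s] z(1) \<open>i' = i\<close> \<open>s' = s\<close> by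
          (auto simp: P_def N_def)
    qed (use mem[OF val xl] \<tau> in \<open>auto simp: P_def N_def\<close>)
    have "y 1 i s \<notin> N"
      using sgn_cellD[of "y 1 i s" "y (-1) i s" i s j] j ejy \<delta>(1) by (auto simp: N_def sgn_if)
    moreover have "y 1 i s \<in> P" using yself[OF xl] by (simp add: P_def)
    ultimately have PN: "P \<noteq> N" by blast
    have "weight (cell (y r i s) i s) = 1" if "\<bar>r\<bar> = 1" for r
    proof -
      have "fib (y r i s) = (s * ell i (y r i s)) *\<^sub>R cvec i" using yl[OF xl] by (simp add: lift_def)
      then have "fib (y r i s) \<noteq> 0" using s nzy[OF that i] by auto
      then show ?thesis using yself[OF xl] by (auto simp: weight_def)
    qed
    then have w: "weight P = 1" "weight N = 1" by (simp_all add: P_def N_def)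
    define u where "u \<sigma> = (if \<sigma> = P then 1 *\<^sub>R lifted i s (dvec j) else (-1) *\<^sub>R lifted i s (dvec j))" for \<sigma>
    show ?thesis
    proof (intro exI[of _ u] conjI)
      have "lattice_normal \<sigma> \<tau> (u \<sigma>)" if "\<sigma> \<in> {P, N}" for \<sigma>
        using that normal[OF xl s(3), of 1] normal[OF xl s(3), of "-1"] PN \<tau> by (auto simp: u_def P_def N_def)
      then show "\<forall>\<sigma>\<in>cells. aff_dim \<sigma> = int (card K) \<and> \<tau> face_of \<sigma> \<longrightarrow> lattice_normal \<sigma> \<tau> (u \<sigma>)"
        using A by blast
      show "(\<Sum>\<sigma> | \<sigma> \<in> cells \<and> aff_dim \<sigma> = int (card K) \<and> \<tau> face_of \<sigma>. weight \<sigma> *\<^sub>R u \<sigma>)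
        \<in> span (direction_lattice \<tau>)"
        unfolding A using PN w by (simp add: u_def span_zero)
    qed
  next
    case True
    have few: "few_positive x" using v True by (simp add: valid_def)
    have fx: "fib x = 0" using xl True by (simp add: lift_def)
    have xl0: "x \<in> lift i' 0" "x \<in> lift j s'" for i' s' using fx j by (simp_all add: lift_def)
    \<comment> \<open>Since \<open>ell j\<close> vanishes at x, the flat sheet and both half-sheets
      in direction \<open>cvec j\<close> share the cell \<tau>.\<close>
    have \<tau>0: "cell x j s' = \<tau>" for s' using \<tau> True cell_vanishing[OF j] cell_zero[of x i 0] by metis
    define F P N where "F = cell (y (-1) j 0) j 0" and "P = cell (y 1 j 1) j 1" and "N
      = cell (y 1 j (-1)) j (-1)"
    \<comment> \<open>The two other forms are nonzero and opposite, so one is positive. This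
      prevents the flat sheet from continuing to the side where \<open>ell j\<close> is
      positive.\<close>
    have pos_x: "\<exists>l<3. l \<noteq> j \<and> 0 < ell l x"
      using ell_sum[of x] j nz unfolding less_3_cases by (smt (verit))
    have valF: "valid (y (-1) j 0) j 0"
    proof -
      have "few_positive (y (-1) j 0)"
        unfolding few_positive_def
      proof (intro allI impI, elim conjE)
        fix l l' :: nat assume l: "l < 3" "l' < 3" "0 < ell l (y (-1) j 0)" "0 < ell l' (y (-1) j 0)"
        then have "l \<noteq> j" "l' \<noteq> j" using ejy[of "-1" j 0] \<delta>(1) by auto
        then have "0 < ell l x" "0 < ell l' x" using posy[of "-1" l j 0] posy[of "-1" l' j 0] l by auto
        then show "l = l'" using few l unfolding few_positive_def by blast
      qed
      then show ?thesis using j yl[OF xl0(2)] by (simp add: valid_def)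
    qed
    have valP: "valid (y 1 j s') j s'" if "\<bar>s'\<bar> = 1" for s'
      using that j yl[OF xl0(2)] ejy \<delta>(1) by (simp add: valid_def)
    have A: "?A = {F, P, N}"
    proof (intro equalityI subsetI)
      fix \<sigma> assume "\<sigma> \<in> ?A"
      then obtain z i' s' where z: "\<sigma> = cell z i' s'" "valid z i' s'" "ell j z \<noteq> 0" "fib x
        = (s' * ell i' x) *\<^sub>R cvec i'"
        "\<forall>l<3. l \<noteq> j \<longrightarrow> sgn (ell l z) = sgn (ell l x)" using memD by blast
      have i': "i' < 3" using z(2) by (simp add: valid_def)
      show "\<sigma> \<in> {F, P, N}"
      proof (cases "s' = 0")
        case True
        obtain l where l: "l < 3" "l \<noteq> j" "0 < ell l x" using pos_x by blast
        then have "0 < ell l z" using z(5) by (auto simp: sgn_if split: if_splits)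
        moreover have "few_positive z" using z(2) True by (simp add: valid_def)
        ultimately have "\<not> 0 < ell j z" using l j unfolding few_positive_def by blast
        then have "sgn (ell j z) = -1" using z(3) by (simp add: sgn_if)
        then have "cell z j 0 = F" using cong[OF z(5), of "-1" j 0] by (simp add: F_def)
        then show ?thesis using z(1) True cell_zero[of z i' j] by simp
      next
        case False
        then have s': "\<bar>s'\<bar> = 1" "0 < ell i' z" using z(2) by (auto simp: valid_def)
        \<comment> \<open>The sheet passes through x, whose fibre component is 0; with nonzero slope
          its form must vanish at x, and only \<open>ell j\<close> does.\<close>
        have "ell i' x = 0" using z(4) fx False by simp
        then have "i' = j" using nzj i' by blast
        then have "sgn (ell j z) = 1" using s' by simp
        then have "\<sigma> = cell (y 1 j s') j s'" using cong[OF z(5), of 1 j s'] z(1) \<open>i' = j\<close> by simp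
        moreover have "s' = 1 \<or> s' = -1" using s' by (auto simp: abs_if split: if_splits)
        ultimately show ?thesis by (auto simp: P_def N_def)
      qed
    next
      fix \<sigma> assume "\<sigma> \<in> {F, P, N}"
      then show "\<sigma> \<in> ?A"
        using mem[OF valF xl0(2) \<tau>0] mem[OF valP xl0(2) \<tau>0, of 1] mem[OF valP xl0(2) \<tau>0, of "-1"]
        unfolding F_def P_def N_def by (elim insertE) simp_all
    qed
    have fy: "fib (y 1 j s') = (s' * \<delta>) *\<^sub>R cvec j" for s'
      using yl[OF xl0(2), of 1 s'] ejy[of 1 j s'] by (simp add: lift_def)
    have "y 1 j s' \<notin> F" for s'
      using sgn_cellD[of "y 1 j s'" "y (-1) j 0" j 0 j] j ejy \<delta>(1) by (auto simp: F_def sgn_if)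
    moreover have yP: "y 1 j 1 \<in> P" "y 1 j (-1) \<in> N" using yself[OF xl0(2)] by (simp_all add: P_def N_def)
    moreover have "y 1 j 1 \<notin> N"
    proof
      assume "y 1 j 1 \<in> N"
      then have "fib (y 1 j 1) = ((-1) * ell j (y 1 j 1)) *\<^sub>R cvec j"
        by (simp add: N_def cell_def sign_cell_def lift_def)
      then show False using fy[of 1] ejy[of 1 j 1] \<delta>(1) by (simp del: scaleR_minus_left)
    qed
    ultimately have ne: "F \<noteq> P" "F \<noteq> N" "P \<noteq> N" by blast+
    have w: "weight F = 2" "weight P = 1" "weight N = 1"
    proof -
      have "F \<subseteq> {p. fib p = 0}" by (auto simp: F_def cell_def sign_cell_def lift_def)
      then show "weight F = 2" by (simp add: weight_def)
      have "fib (y 1 j 1) \<noteq> 0" "fib (y 1 j (-1)) \<noteq> 0" using fy \<delta>(1) by simp_all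
      then show "weight P = 1" "weight N = 1" using yP by (auto simp: weight_def)
    qed
    define u where "u \<sigma> = (if \<sigma> = F then (-1) *\<^sub>R lifted j 0 (dvec j) else if \<sigma>
      = P then 1 *\<^sub>R lifted j 1 (dvec j)
      else 1 *\<^sub>R lifted j (-1) (dvec j))" for \<sigma>
    show ?thesis
    proof (intro exI[of _ u] conjI)
      have "lattice_normal \<sigma> \<tau> (u \<sigma>)" if "\<sigma> \<in> {F, P, N}" for \<sigma>
        using that normal[OF xl0(2), of 0 "-1"] normal[OF xl0(2), of 1 1] normal[OF xl0(2), of "-1" 1] ne \<tau>0
        by (auto simp: u_def F_def P_def N_def)
      then show "\<forall>\<sigma>\<in>cells. aff_dim \<sigma> = int (card K) \<and> \<tau> face_of \<sigma> \<longrightarrow> lattice_normal \<sigma> \<tau> (u \<sigma>)"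
        using A by blast
      \<comment> \<open>The fibre parts of slopes 1 and -1 cancel, and the two base parts add up to
        twice the flat vector.\<close>
      have "2 *\<^sub>R ((-1) *\<^sub>R lifted j 0 (dvec j)) + (1 *\<^sub>R lifted j 1 (dvec j) + 1 *\<^sub>R lifted j (-1)
        (dvec j)) = 0"
        by (simp add: lifted_def scaleR_2)
      then show "(\<Sum>\<sigma> | \<sigma> \<in> cells \<and> aff_dim \<sigma> = int (card K) \<and> \<tau> face_of \<sigma>. weight \<sigma> *\<^sub>R u \<sigma>)
        \<in> span (direction_lattice \<tau>)"
        unfolding A using ne w by (simp add: u_def span_zero)
    qed
  qed
qed

lemma tropical_variety_cells: "tropical_variety (card K) cells weight"
  unfolding tropical_variety_def
  using finite_cells rational_polyhedral_complex_cells pure_dimensional_cells balanced_cells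
  by (simp add: weight_def)

section \<open>Homology of the complement\<close>

text \<open>Written with \<open>l \<notin> - K\<close> to match the shape of the coordinate
  subspaces in \<open>subspace_coordinates\<close> and \<open>dim_coordinates\<close>.\<close>

definition fibre :: "(real^'n) set" where
  "fibre = {p. \<forall>l. l \<notin> - K \<longrightarrow> p $ l = 0}"

text \<open>For distinct i, j below 3, the base vector where \<open>ell i\<close> is 1,
  \<open>ell j\<close> is 0 and the third form is -1. The coordinates a and b are the values of
  \<open>ell 0\<close> and \<open>ell 1\<close>.\<close>

definition edge_vec :: "nat \<Rightarrow> nat \<Rightarrow> real^'n" where
  "edge_vec i j = (let t = \<lambda>l. if l = i then 1 else if l = j then 0 else -1
             in t 0 *\<^sub>R axis a 1 + t 1 *\<^sub>R axis b 1)"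

text \<open>A point of the sector where only \<open>ell j\<close> is positive: for j below 3 it has
  the value 1 there and the others have the value -1/2.\<close>

definition base_pt :: "nat \<Rightarrow> real^'n" where
  "base_pt j = (let t = \<lambda>l. if l = j then 1 else -1/2 in t 0 *\<^sub>R axis a 1 + t 1 *\<^sub>R axis b 1)"

text \<open>Each point of the variety may serve as its own representative, so membership becomes a
  condition on the fibre component over a base point.\<close>

lemma mem_Union_cells: "p \<in> \<Union>cells \<longleftrightarrow> (\<exists>i s. valid p i s)"
proof
  assume "p \<in> \<Union>cells"
  then obtain x i s where "valid x i s" "p \<in> cell x i s" by (auto simp: cells_def)
  then show "\<exists>i s. valid p i s" using valid_in_cell by blast
next
  assume "\<exists>i s. valid p i s"
  then obtain i s where "valid p i s" by blast
  then show "p \<in> \<Union>cells" using valid_self unfolding cells_def by blast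
qed

lemma not_in_Union_cells:
  assumes "fib p \<noteq> 0" "\<And>i s. i < 3 \<Longrightarrow> 0 < ell i p \<Longrightarrow> \<bar>s\<bar> = 1 \<Longrightarrow> fib p \<noteq> (s * ell i p) *\<^sub>R cvec i"
  shows "p \<in> - \<Union>cells"
  using assms unfolding Compl_iff mem_Union_cells valid_def lift_def by auto

section \<open>The fibre and the chosen base points\<close>

lemma fibre_iff: "p \<in> fibre \<longleftrightarrow> fib p = p"
  by (auto simp: fibre_def fib_def vec_eq_iff)

lemma subspace_fibre: "subspace fibre"
  unfolding fibre_def by (rule subspace_coordinates)

lemma dim_fibre: "dim fibre = CARD('n) - card K"
  unfolding fibre_def dim_coordinates by (simp add: Compl_eq_Diff_UNIV card_Diff_subset)

lemma cvec_fibre [simp]: "cvec i \<in> fibre"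
  by (simp add: fibre_iff)

lemma ell_fibre: "p \<in> fibre \<Longrightarrow> ell j p = 0"
  by (metis ell_fib fibre_iff)

lemma ell_edge_vec:
  assumes "i < 3" "j < 3" "i \<noteq> j"
  shows "ell i (edge_vec i j) = 1" "ell j (edge_vec i j) = 0"
  using assms ab unfolding less_3_cases edge_vec_def Let_def by (elim disjE; simp add: ell_def axis_def)+

lemma ell_base_pt:
  assumes "l < 3" "j < 3"
  shows "ell l (base_pt j) = (if l = j then 1 else -1/2)"
  using assms ab unfolding less_3_cases base_pt_def Let_def by (elim disjE; simp add: ell_def axis_def)

lemma fib_edge_vec [simp]: "fib (edge_vec i j) = 0" and fib_base_pt [simp]: "fib (base_pt j) = 0"
  using ab by (auto simp: fib_def edge_vec_def base_pt_def Let_def axis_def vec_eq_iff)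

text \<open>Places \<open>base_pt j\<close> at t = -1/2 on the line
  \<open>t *\<^sub>R edge_vec i j + edge_vec j i\<close>, along which \<open>ell j\<close> stays 1
  while \<open>ell i\<close> equals t.\<close>

lemma base_pt_eq:
  assumes "i < 3" "j < 3" "i \<noteq> j"
  shows "base_pt j = (-1/2) *\<^sub>R edge_vec i j + edge_vec j i"
  using assms ab unfolding less_3_cases base_pt_def edge_vec_def Let_def
  by (elim disjE; simp add: vec_eq_iff axis_def)

text \<open>These bounds justify the radii used below: 1/2 is less than every
  \<open>norm (cvec i)\<close>, and 3 is greater.\<close>

lemma norm_cvec: "1 \<le> norm (cvec i)" "norm (cvec i) \<le> 2"
proof -
  have "1 \<le> \<bar>cvec i $ c\<bar> \<or> 1 \<le> \<bar>cvec i $ d\<bar>" using cd by (auto simp: cvec_def axis_def)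
  then show "1 \<le> norm (cvec i)" using component_le_norm_cart[of "cvec i"] by (meson order_trans)
  have "norm (- axis c 1 - axis d (1::real)) \<le> norm (- axis c (1::real) :: real^'n) + norm (axis d
    (1::real) :: real^'n)"
    by (rule norm_triangle_ineq4)
  then show "norm (cvec i) \<le> 2" by (auto simp: cvec_def)
qed

lemma dual_functional:
  assumes "i < 3" "j < 3" "i \<noteq> j"
  obtains \<phi> where "linear \<phi>" "\<phi> (cvec i) = 1" "\<phi> (cvec j) = (0::real)"
proof -
  have "\<exists>u v. u * cvec i $ c + v * cvec i $ d = 1 \<and> u * cvec j $ c + v * cvec j $ d = 0"
  proof -
    consider "i = 0 \<and> j = 1" | "i = 0 \<and> j = 2" | "i = 1 \<and> j = 0" | "i = 1 \<and> j = 2" | "i = 2 \<and> j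
      = 0" | "i = 2 \<and> j = 1"
      using assms unfolding less_3_cases by auto
    then show ?thesis
    proof cases
      case 1 then show ?thesis using cd by (intro exI[of _ 1] exI[of _ 0]) (auto simp: cvec_def axis_def)
    next
      case 2 then show ?thesis using cd by (intro exI[of _ 1] exI[of _ "-1"]) (auto simp: cvec_def axis_def)
    next
      case 3 then show ?thesis using cd by (intro exI[of _ 0] exI[of _ 1]) (auto simp: cvec_def axis_def)
    next
      case 4 then show ?thesis using cd by (intro exI[of _ "-1"] exI[of _ 1]) (auto simp: cvec_def axis_def)
    next
      case 5 then show ?thesis using cd by (intro exI[of _ 0] exI[of _ "-1"]) (auto simp: cvec_def axis_def)
    next
      case 6 then show ?thesis using cd by (intro exI[of _ "-1"] exI[of _ 0]) (auto simp: cvec_def axis_def)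
    qed
  qed
  then obtain u v where "u * cvec i $ c + v * cvec i $ d = 1" "u * cvec j $ c + v * cvec j $ d = 0" by blast
  moreover have "linear (\<lambda>p :: real^'n. u * p $ c + v * p $ d)"
    by (rule linearI) (simp_all add: algebra_simps)
  ultimately show thesis using that by blast
qed

section \<open>Classes of spheres in the fibres\<close>

abbreviation fibre_sphere :: "(real^'n) set" where "fibre_sphere \<equiv> sphere 0 1 \<inter> fibre"

definition sphere_class :: "int \<Rightarrow> (real^'n) chain set \<Rightarrow> (real^'n) set \<Rightarrow> (real^'n \<Rightarrow> real^'n) \<Rightarrow>
  (real^'n) chain set" where
  "sphere_class p g X f = hom_induced p (top_of_set fibre_sphere) {} (top_of_set X) {} f g"

lemma big_sphere_avoids:
  assumes "fib x = 0" "\<And>l. l < 3 \<Longrightarrow> ell l x \<le> 1" "s \<in> fibre_sphere"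
  shows "x + 3 *\<^sub>R s \<in> - \<Union>cells"
proof (rule not_in_Union_cells)
  have f: "fib (x + 3 *\<^sub>R s) = 3 *\<^sub>R s" using assms by (simp add: fib_add fib_scale fibre_iff)
  then show "fib (x + 3 *\<^sub>R s) \<noteq> 0" using assms by auto
  fix i :: nat and r :: real assume i: "i < 3" "0 < ell i (x + 3 *\<^sub>R s)" "\<bar>r\<bar> = 1"
  have e: "ell i (x + 3 *\<^sub>R s) = ell i x" using assms(3) by (simp add: ell_add ell_scale ell_fibre)
  have "ell i x * norm (cvec i) \<le> 1 * 2"
    using i e assms(2)[OF i(1)] norm_cvec[of i] by (intro mult_mono) auto
  then have "norm ((r * ell i (x + 3 *\<^sub>R s)) *\<^sub>R cvec i) \<le> 2"
    using i e by (simp add: abs_mult)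
  moreover have "norm (3 *\<^sub>R s) = 3" using assms(3) by simp
  ultimately show "fib (x + 3 *\<^sub>R s) \<noteq> (r * ell i (x + 3 *\<^sub>R s)) *\<^sub>R cvec i"
    unfolding f by (smt (verit))
qed

text \<open>The base points at which all forms are at most 1 form a convex set, so the big sphere
  can be moved along a segment.\<close>

lemma big_sphere_class:
  assumes "fib x = 0" "\<And>l. l < 3 \<Longrightarrow> ell l x \<le> 1" "fib x' = 0" "\<And>l. l < 3 \<Longrightarrow> ell l x' \<le> 1"
  shows "sphere_class p g (- \<Union>cells) (\<lambda>s. x + 3 *\<^sub>R s) = sphere_class p g (- \<Union>cells) (\<lambda>s. x' + 3 *\<^sub>R s)"
proof -
  let ?h = "\<lambda>t s. ((1 - t) *\<^sub>R x + t *\<^sub>R x') + 3 *\<^sub>R s"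
  have "hom_induced p (top_of_set fibre_sphere) {} (top_of_set (- \<Union>cells)) {} (?h 0)
      = hom_induced p (top_of_set fibre_sphere) {} (top_of_set (- \<Union>cells)) {} (?h 1)"
  proof (rule hom_induced_homotopy)
    show "continuous_on ({0..1} \<times> fibre_sphere) (\<lambda>(t, s). ?h t s)"
      unfolding case_prod_beta by (intro continuous_intros)
    fix t :: real and s assume t: "t \<in> {0..1}" and s: "s \<in> fibre_sphere"
    have "ell l ((1 - t) *\<^sub>R x + t *\<^sub>R x') \<le> 1" if "l < 3" for l
      unfolding ell_add ell_scale real_scaleR_def using t assms(2,4)[OF that]
      by (intro convex_bound_le) auto
    then show "?h t s \<in> - \<Union>cells"
      using assms s by (intro big_sphere_avoids) (auto simp: fib_add fib_scale)
  qed
  then show ?thesis by (simp add: sphere_class_def)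
qed

text \<open>Over this base point the forms i and j equal t and 1, and the third is -1 - t < 0. The
  ellipsoid keeps the points of sheet i inside, as \<open>2 * t < 1/2 + 2 * t\<close> for t > 0, and
  those of sheet j outside, as 1/2 < 1.\<close>

lemma stretching_avoids:
  assumes ij: "i < 3" "j < 3" "i \<noteq> j" and \<phi>: "linear \<phi>" "\<phi> (cvec i) = 1" "\<phi> (cvec j) = (0::real)"
    and t: "-1/2 \<le> t" "t \<le> 1" and s: "s \<in> fibre_sphere"
  shows "t *\<^sub>R edge_vec i j + edge_vec j i + ((1/2) *\<^sub>R s + (2 * max 0 t * \<phi> s) *\<^sub>R cvec i)
    \<in> - \<Union>cells" (is "?x \<in> _")
proof (rule not_in_Union_cells)
  let ?v = "(1/2) *\<^sub>R s + (2 * max 0 t * \<phi> s) *\<^sub>R cvec i"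
  have f: "fib ?x = ?v" using s by (simp add: fib_add fib_scale fibre_iff)
  have es: "ell l s = 0" for l using s by (simp add: ell_fibre)
  have e: "ell i ?x = t" "ell j ?x = 1"
    using ell_edge_vec[OF ij] ell_edge_vec[OF ij(2,1)] ij(3) es by (simp_all add: ell_add ell_scale)
  have ns: "norm s = 1" using s by simp
  have pos: "(0::real) < 1/2" "0 \<le> 2 * max 0 t" by auto
  have "?v \<noteq> 0 *\<^sub>R cvec i"
    using stretch_avoids[OF \<phi> pos ns, of 0 1] norm_cvec[of j] t by auto
  then show "fib ?x \<noteq> 0" unfolding f by simp
  fix l :: nat and r :: real assume l: "l < 3" "0 < ell l ?x" and r: "\<bar>r\<bar> = 1"
  consider "l = i" | "l = j" | "l \<noteq> i" "l \<noteq> j" by blast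
  then show "fib ?x \<noteq> (r * ell l ?x) *\<^sub>R cvec l"
  proof cases
    case 1
    have "\<bar>r * t\<bar> * norm (cvec i) < 1/2 + 2 * max 0 t"
    proof -
      have "t > 0" using l(2) e 1 by simp
      then have "\<bar>r * t\<bar> * norm (cvec i) \<le> t * 2" using r norm_cvec[of i] by (simp add: abs_mult)
      then show ?thesis using \<open>t > 0\<close> by simp
    qed
    then have "?v \<noteq> (r * t) *\<^sub>R cvec i"
      using stretch_avoids[OF \<phi> pos ns, of "r * t" 1] norm_cvec[of j] by auto
    then show ?thesis unfolding f using e 1 by simp
  next
    case 2
    have "?v \<noteq> r *\<^sub>R cvec j"
      using stretch_avoids[OF \<phi> pos ns, of 0 r] norm_cvec[of j] r t by auto
    then show ?thesis unfolding f using e 2 by simp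
  next
    case 3
    have "ell i ?x + ell j ?x + ell l ?x = 0"
      using ell_sum[of ?x] ij l(1) 3 unfolding less_3_cases
        by (elim disjE) (simp_all add: add.commute add.left_commute)
    then show ?thesis using e l(2) t by simp
  qed
qed

lemma small_sphere_stretch:
  assumes ij: "i < 3" "j < 3" "i \<noteq> j" and \<phi>: "linear \<phi>" "\<phi> (cvec i) = 1" "\<phi> (cvec j) = (0::real)"
  shows "sphere_class p g (- \<Union>cells) (\<lambda>s. base_pt j + (1/2) *\<^sub>R s)
    = sphere_class p g (- \<Union>cells) (\<lambda>s. (edge_vec i j + edge_vec j i) + ((1/2) *\<^sub>R s + (2 * \<phi> s) *\<^sub>R cvec i))"
proof -
  \<comment> \<open>This runs from -1/2, where \<open>max 0\<close> makes the sphere round, to 1,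
    where it is fully stretched.\<close>
  let ?t = "\<lambda>t::real. 3/2 * t - 1/2"
  let ?h = "\<lambda>t s. ?t t *\<^sub>R edge_vec i j + edge_vec j i + ((1/2) *\<^sub>R s + (2 * max 0 (?t t) * \<phi> s) *\<^sub>R cvec i)"
  have cont: "continuous_on A \<phi>" for A using \<phi>(1) by (simp add: linear_continuous_on linear_linear)
  have "hom_induced p (top_of_set fibre_sphere) {} (top_of_set (- \<Union>cells)) {} (?h 0)
      = hom_induced p (top_of_set fibre_sphere) {} (top_of_set (- \<Union>cells)) {} (?h 1)"
  proof (rule hom_induced_homotopy)
    show "continuous_on ({0..1} \<times> fibre_sphere) (\<lambda>(t, s). ?h t s)"
      unfolding case_prod_beta
      by (intro continuous_intros continuous_on_compose2[OF cont[of UNIV]]) auto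
    fix t :: real and s assume "t \<in> {0..1}" and s: "s \<in> fibre_sphere"
    then show "?h t s \<in> - \<Union>cells" by (intro stretching_avoids[OF ij \<phi> _ _ s]) auto
  qed
  then show ?thesis using base_pt_eq[OF ij] by (simp add: sphere_class_def)
qed

lemma sphere_class_push:
  assumes "continuous_on fibre_sphere f" "f ` fibre_sphere \<subseteq> X" "continuous_on X k" "k ` X \<subseteq> Y"
  shows "hom_induced p (top_of_set X) {} (top_of_set Y) {} k (sphere_class p g X f)
    = sphere_class p g Y (\<lambda>s. k (f s))"
  unfolding sphere_class_def using assms by (rule hom_induced_compose_top_of_set)

text \<open>Over the base point where \<open>ell i = ell j = 1\<close> the third form is -2, so the
  complement contains the fibre with four points removed. The relation between the two ellipsoids
  and the round sphere holds there and is pushed into the complement; homotopies then move the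
  ellipsoids to small spheres at \<open>base_pt j\<close> and \<open>base_pt i\<close>.\<close>

lemma small_spheres_sum:
  assumes ij: "i < 3" "j < 3" "i \<noteq> j" and p: "p > 0" and g: "g
    \<in> carrier (homology_group p (top_of_set fibre_sphere))"
  shows "sphere_class p g (- \<Union>cells) (\<lambda>s. base_pt j + (1/2) *\<^sub>R s) \<otimes>\<^bsub>homology_group p (top_of_set (- \<Union>cells))\<^esub>
      sphere_class p g (- \<Union>cells) (\<lambda>s. base_pt i + (1/2) *\<^sub>R s)
        = sphere_class p g (- \<Union>cells) (\<lambda>s. base_pt 0 + 3 *\<^sub>R s)"
proof -
  obtain \<phi> where \<phi>: "linear \<phi>" "\<phi> (cvec i) = 1" "\<phi> (cvec j) = (0::real)" using dual_functional[OF ij] .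
  obtain \<psi> where \<psi>: "linear \<psi>" "\<psi> (cvec j) = 1" "\<psi> (cvec i) = (0::real)"
    using dual_functional[OF ij(2,1)] ij(3) by metis
  let ?X = "- \<Union>cells" and ?F = "{cvec i, - cvec i, cvec j, - cvec j}"
  let ?x = "edge_vec i j + edge_vec j i"
  let ?a = "\<lambda>s. (1/2) *\<^sub>R s + (2 * \<phi> s) *\<^sub>R cvec i" and ?b = "\<lambda>s. (1/2) *\<^sub>R s + (2 * \<psi> s) *\<^sub>R cvec j"
  let ?k = "\<lambda>v. ?x + v"
  have cont: "continuous_on A \<phi>" "continuous_on A \<psi>" for A
    using \<phi>(1) \<psi>(1) by (simp_all add: linear_continuous_on linear_linear)
  \<comment> \<open>The constants are e = 1/2, k = 2, R = 3, compatible with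
    \<open>1 \<le> norm (cvec l)\<close> and \<open>norm (cvec l) \<le> 2\<close>.\<close>
  have sum: "sphere_class p g (fibre - ?F) ?a \<otimes>\<^bsub>homology_group p (top_of_set (fibre - ?F))\<^esub>
    sphere_class p g (fibre - ?F) ?b
      = sphere_class p g (fibre - ?F) (\<lambda>s. 3 *\<^sub>R s)"
    unfolding sphere_class_def using \<phi> \<psi> norm_cvec[of i] norm_cvec[of j] g p subspace_fibre
    by (intro stretched_spheres_sum) auto
  have ex: "ell i ?x = 1" "ell j ?x = 1"
    using ell_edge_vec[OF ij] ell_edge_vec[OF ij(2,1)] ij(3) by (simp_all add: ell_add)
  have ex3: "ell l ?x < 0" if "l < 3" "l \<noteq> i" "l \<noteq> j" for l
    using ell_sum[of ?x] ij that ex unfolding less_3_cases by (elim disjE) simp_all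
  have kX: "?k ` (fibre - ?F) \<subseteq> ?X"
  proof
    fix q assume "q \<in> ?k ` (fibre - ?F)"
    then obtain v where v: "q = ?x + v" "v \<in> fibre" "v \<notin> ?F" by blast
    have e: "ell l q = ell l ?x" for l using v(1,2) by (simp add: ell_add ell_fibre)
    have f: "fib q = v" using v(1,2) by (simp add: fib_add fibre_iff)
    show "q \<in> ?X" unfolding Compl_iff mem_Union_cells
    proof (intro notI, elim exE)
      fix l s assume val: "valid q l s"
      have l: "l < 3" "fib q = (s * ell l q) *\<^sub>R cvec l" using val by (auto simp: valid_def lift_def)
      show False
      proof (cases "s = 0")
        case True
        \<comment> \<open>Two forms are positive here, so the flat sheet is absent over this base
          point.\<close>
        then have "few_positive q" using val by (simp add: valid_def)
        then show False using ij ex e unfolding few_positive_def by (metis zero_less_one)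
      next
        case False
        then have s: "\<bar>s\<bar> = 1" "0 < ell l q" using val by (auto simp: valid_def)
        then have "l = i \<or> l = j" using ex3[OF l(1)] e by fastforce
        then have "v = s *\<^sub>R cvec i \<or> v = s *\<^sub>R cvec j" using l(2) f e ex by auto
        moreover have "s = 1 \<or> s = -1" using s(1) by (auto simp: abs_if split: if_splits)
        ultimately show False using v(3) by auto
      qed
    qed
  qed
  have ck: "continuous_on (fibre - ?F) ?k" by (intro continuous_intros)
  have pushed: "hom_induced p (top_of_set (fibre - ?F)) {} (top_of_set ?X) {} ?k (sphere_class p g
    (fibre - ?F) f)
      = sphere_class p g ?X (\<lambda>s. ?x + f s)" if "continuous_on fibre_sphere f" "f ` fibre_sphere \<subseteq>
        fibre - ?F" for f
    using that ck kX by (rule sphere_class_push)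
  interpret group_hom "homology_group p (top_of_set (fibre - ?F))" "homology_group p (top_of_set ?X)"
    "hom_induced p (top_of_set (fibre - ?F)) {} (top_of_set ?X) {} ?k"
    by (simp add: group_hom_def group_hom_axioms_def hom_induced_empty_hom)
  have e12: "(0::real) < 1/2" "(0::real) \<le> 2" by auto
  have ain: "?a ` fibre_sphere \<subseteq> fibre - ?F"
  proof
    fix q assume "q \<in> ?a ` fibre_sphere"
    then obtain s where s: "s \<in> fibre_sphere" "q = ?a s" by blast
    have "?a s \<noteq> r *\<^sub>R cvec i \<and> ?a s \<noteq> r *\<^sub>R cvec j" if "\<bar>r\<bar> = 1" for r
      using stretch_avoids[OF \<phi> e12, of s r r] s(1) norm_cvec[of i] norm_cvec[of j] that by simp
    from this[of 1] this[of "-1"] have "?a s \<notin> ?F" by simp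
    moreover have "?a s \<in> fibre"
      using s(1) by (intro subspace_add[OF subspace_fibre] subspace_scale[OF subspace_fibre]) auto
    ultimately show "q \<in> fibre - ?F" using s(2) by simp
  qed
  have bin: "?b ` fibre_sphere \<subseteq> fibre - ?F"
  proof
    fix q assume "q \<in> ?b ` fibre_sphere"
    then obtain s where s: "s \<in> fibre_sphere" "q = ?b s" by blast
    have "?b s \<noteq> r *\<^sub>R cvec j \<and> ?b s \<noteq> r *\<^sub>R cvec i" if "\<bar>r\<bar> = 1" for r
      using stretch_avoids[OF \<psi> e12, of s r r] s(1) norm_cvec[of i] norm_cvec[of j] that by simp
    from this[of 1] this[of "-1"] have "?b s \<notin> ?F" by simp
    moreover have "?b s \<in> fibre"
      using s(1) by (intro subspace_add[OF subspace_fibre] subspace_scale[OF subspace_fibre]) auto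
    ultimately show "q \<in> fibre - ?F" using s(2) by simp
  qed
  have rin: "(\<lambda>s. 3 *\<^sub>R s) ` fibre_sphere \<subseteq> fibre - ?F"
  proof
    fix q assume "q \<in> (\<lambda>s. 3 *\<^sub>R s) ` fibre_sphere"
    then have "norm q = 3" "q \<in> fibre" by (auto intro: subspace_scale[OF subspace_fibre])
    moreover have "norm y \<le> 2" if "y \<in> ?F" for y using that norm_cvec[of i] norm_cvec[of j] by auto
    ultimately show "q \<in> fibre - ?F" by fastforce
  qed
  have "sphere_class p g ?X (\<lambda>s. ?x + ?a s) \<otimes>\<^bsub>homology_group p (top_of_set ?X)\<^esub> sphere_class p g ?X
    (\<lambda>s. ?x + ?b s)
      = sphere_class p g ?X (\<lambda>s. ?x + 3 *\<^sub>R s)"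
  proof -
    have "continuous_on fibre_sphere ?a" "continuous_on fibre_sphere ?b" "continuous_on fibre_sphere
      (\<lambda>s. 3 *\<^sub>R s)"
      by (intro continuous_intros cont)+
    then have P: "hom_induced p (top_of_set (fibre - ?F)) {} (top_of_set ?X) {} ?k (sphere_class p g
      (fibre - ?F) ?a) = sphere_class p g ?X (\<lambda>s. ?x + ?a s)"
      "hom_induced p (top_of_set (fibre - ?F)) {} (top_of_set ?X) {} ?k (sphere_class p g (fibre -
        ?F) ?b) = sphere_class p g ?X (\<lambda>s. ?x + ?b s)"
      "hom_induced p (top_of_set (fibre - ?F)) {} (top_of_set ?X) {} ?k (sphere_class p g (fibre -
        ?F) (\<lambda>s. 3 *\<^sub>R s)) = sphere_class p g ?X (\<lambda>s. ?x + 3 *\<^sub>R s)"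
      using pushed ain bin rin by blast+
    show ?thesis unfolding P[symmetric] sum[symmetric]
      by (rule hom_mult[symmetric]) (simp_all add: sphere_class_def hom_induced_carrier)
  qed
  moreover have "sphere_class p g ?X (\<lambda>s. base_pt j + (1/2) *\<^sub>R s) = sphere_class p g ?X (\<lambda>s. ?x + ?a s)"
    using small_sphere_stretch[OF ij \<phi>] by simp
  moreover have "sphere_class p g ?X (\<lambda>s. base_pt i + (1/2) *\<^sub>R s) = sphere_class p g ?X (\<lambda>s. ?x + ?b s)"
    using small_sphere_stretch[OF ij(2,1) _ \<psi>] ij(3) by (simp add: add.commute)
  moreover have "sphere_class p g ?X (\<lambda>s. ?x + 3 *\<^sub>R s) = sphere_class p g ?X (\<lambda>s. base_pt 0 + 3 *\<^sub>R s)"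
  proof (rule big_sphere_class)
    fix l :: nat assume l: "l < 3"
    then show "ell l ?x \<le> 1" using ex ex3[OF l] by fastforce
    show "ell l (base_pt 0) \<le> 1" using ell_base_pt[OF l, of 0] by simp
  qed (simp_all add: fib_add)
  ultimately show ?thesis by simp
qed

text \<open>The pairs (0,1) and (2,1) give the same sum, so cancellation identifies the small
  spheres at 0 and 2; the pair (2,0) then gives the claim.\<close>

lemma doubled_small_sphere:
  assumes p: "p > 0" and g: "g \<in> carrier (homology_group p (top_of_set fibre_sphere))"
  shows "sphere_class p g (- \<Union>cells) (\<lambda>s. base_pt 0 + (1/2) *\<^sub>R s) \<otimes>\<^bsub>homology_group p (top_of_set (- \<Union>cells))\<^esub>
      sphere_class p g (- \<Union>cells) (\<lambda>s. base_pt 0 + (1/2) *\<^sub>R s)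
        = sphere_class p g (- \<Union>cells) (\<lambda>s. base_pt 0 + 3 *\<^sub>R s)"
proof -
  let ?G = "homology_group p (top_of_set (- \<Union>cells))"
  let ?a = "\<lambda>j. sphere_class p g (- \<Union>cells) (\<lambda>s. base_pt j + (1/2) *\<^sub>R s)"
  interpret comm_group ?G by (rule abelian_homology_group)
  have [simp]: "?a j \<in> carrier ?G" for j by (simp add: sphere_class_def hom_induced_carrier)
  have "?a 1 \<otimes>\<^bsub>?G\<^esub> ?a 0 = ?a 1 \<otimes>\<^bsub>?G\<^esub> ?a 2"
    using small_spheres_sum[of 0 1 p g] small_spheres_sum[of 2 1 p g] assms by simp
  then have "?a 0 = ?a 2" by (simp del: One_nat_def)
  then show ?thesis using small_spheres_sum[of 2 0 p g] assms by simp
qed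

text \<open>The plane L is the fibre over \<open>base_pt 0\<close>. Injectivity would transfer the
  doubling relation from the complement to L, but after filling every puncture except
  \<open>cvec 0\<close> the small sphere is null and the big one is not.\<close>

lemma not_globally_convex_complement:
  assumes m: "card K + 2 \<le> CARD('n)"
  shows "\<not> globally_convex (CARD('n) - card K) (- \<Union>cells)"
proof
  let ?m = "CARD('n) - card K" and ?X = "- \<Union>cells"
  define L where "L = (\<lambda>v. base_pt 0 + v) ` fibre"
  define p where "p = int ?m - 1"
  assume conv: "globally_convex ?m ?X"
  \<comment> \<open>The fibre has dimension at least 2, so the degree is positive and reduced
    homology is ordinary homology.\<close>
  have p: "p > 0" using m by (auto simp: p_def)
  have "affine L" unfolding L_def affine_translation[symmetric]
    by (rule subspace_imp_affine[OF subspace_fibre])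
  moreover have "aff_dim L = int ?m"
    unfolding L_def aff_dim_translation_eq aff_dim_subspace[OF subspace_fibre] dim_fibre ..
  ultimately have "inj_on (hom_induced p (top_of_set (L \<inter> ?X)) {} (top_of_set ?X) {} id)
      (carrier (reduced_homology_group p (top_of_set (L \<inter> ?X))))"
    using conv by (simp add: globally_convex_def p_def)
  then have inj: "inj_on (hom_induced p (top_of_set (L \<inter> ?X)) {} (top_of_set ?X) {} id)
      (carrier (homology_group p (top_of_set (L \<inter> ?X))))"
    using p by (simp add: un_reduced_homology_group)
  obtain g where g: "g \<in> carrier (homology_group p (top_of_set fibre_sphere))"
      "g \<noteq> \<one>\<^bsub>homology_group p (top_of_set fibre_sphere)\<^esub>"
  proof (rule unit_sphere_homology_nontrivial[OF subspace_fibre dim_fibre])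
    show "2 \<le> ?m" using m by simp
  qed (simp add: p_def)
  let ?a = "\<lambda>s. base_pt 0 + (1/2) *\<^sub>R s" and ?b = "\<lambda>s. base_pt 0 + 3 *\<^sub>R s"
  let ?Y = "L \<inter> ?X" and ?Q = "fibre - {cvec 0}"
  have a: "continuous_on fibre_sphere ?a" "?a ` fibre_sphere \<subseteq> ?Y"
  proof -
    show "continuous_on fibre_sphere ?a" by (intro continuous_intros)
    obtain \<phi> where \<phi>: "linear \<phi>" "\<phi> (cvec 1) = 1" "\<phi> (cvec 0) = (0::real)"
      using dual_functional[of 1 0] by auto
    \<comment> \<open>At t = -1/2 the base point is \<open>base_pt 0\<close> and the stretching is
      0.\<close>
    have "?a s \<in> ?X" if "s \<in> fibre_sphere" for s
      using stretching_avoids[OF _ _ _ \<phi>, of "-1/2" s] base_pt_eq[of 1 0] that by simp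
    moreover have "?a s \<in> L" if "s \<in> fibre_sphere" for s
      using that unfolding L_def by (intro imageI subspace_scale[OF subspace_fibre]) auto
    ultimately show "?a ` fibre_sphere \<subseteq> ?Y" by blast
  qed
  have b: "continuous_on fibre_sphere ?b" "?b ` fibre_sphere \<subseteq> ?Y"
  proof -
    show "continuous_on fibre_sphere ?b" by (intro continuous_intros)
    have "?b s \<in> ?X" if "s \<in> fibre_sphere" for s
      using that ell_base_pt[of _ 0] by (intro big_sphere_avoids) auto
    moreover have "?b s \<in> L" if "s \<in> fibre_sphere" for s
      using that unfolding L_def by (intro imageI subspace_scale[OF subspace_fibre]) auto
    ultimately show "?b ` fibre_sphere \<subseteq> ?Y" by blast
  qed
  let ?H = "homology_group p (top_of_set ?Y)"
  let ?i = "hom_induced p (top_of_set ?Y) {} (top_of_set ?X) {} id"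
  let ?r = "hom_induced p (top_of_set ?Y) {} (top_of_set ?Q) {} (\<lambda>v. v - base_pt 0)"
  interpret H: comm_group ?H by (rule abelian_homology_group)
  interpret X: comm_group "homology_group p (top_of_set ?X)" by (rule abelian_homology_group)
  interpret Q: comm_group "homology_group p (top_of_set ?Q)" by (rule abelian_homology_group)
  interpret i: group_hom ?H "homology_group p (top_of_set ?X)" ?i
    by (simp add: group_hom_def group_hom_axioms_def hom_induced_empty_hom)
  interpret r: group_hom ?H "homology_group p (top_of_set ?Q)" ?r
    by (simp add: group_hom_def group_hom_axioms_def hom_induced_empty_hom)
  have [simp]: "sphere_class p g Z f \<in> carrier (homology_group p (top_of_set Z))" for Z f
    by (simp add: sphere_class_def hom_induced_carrier)
  let ?aa = "sphere_class p g ?Y ?a \<otimes>\<^bsub>?H\<^esub> sphere_class p g ?Y ?a"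
  have "?i ?aa = ?i (sphere_class p g ?Y ?b)"
  proof -
    have "?i (sphere_class p g ?Y ?a) = sphere_class p g ?X ?a" "?i (sphere_class p g ?Y ?b)
      = sphere_class p g ?X ?b"
      using a b by (subst sphere_class_push; auto intro: continuous_on_id)+
    then show ?thesis using doubled_small_sphere[OF p g(1)] by simp
  qed
  then have eq: "?aa = sphere_class p g ?Y ?b"
    using inj by (elim inj_onD) simp_all
  have kQ: "(\<lambda>v. v - base_pt 0) ` ?Y \<subseteq> ?Q"
  proof
    fix q assume "q \<in> (\<lambda>v. v - base_pt 0) ` ?Y"
    then have q: "q \<in> fibre" "base_pt 0 + q \<in> ?X" by (auto simp: L_def)
    have "valid (base_pt 0 + cvec 0) 0 1"
      using ell_base_pt[of 0 0] by (simp add: valid_def lift_def fib_add ell_add)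
    then have "base_pt 0 + cvec 0 \<notin> ?X" using mem_Union_cells by blast
    then show "q \<in> ?Q" using q by auto
  qed
  have push: "?r (sphere_class p g ?Y f) = sphere_class p g ?Q (\<lambda>s. f s - base_pt 0)"
    if "continuous_on fibre_sphere f" "f ` fibre_sphere \<subseteq> ?Y" for f
    using that kQ by (intro sphere_class_push) (auto intro!: continuous_intros)
  obtain \<phi> where \<phi>: "linear \<phi>" "\<phi> (cvec 1) = 1" "\<phi> (cvec 0) = (0::real)" using dual_functional[of 1 0] by auto
  \<comment> \<open>With k = 0 the ellipsoid is the round sphere of radius 1/2, which leaves
    \<open>cvec 0\<close> outside.\<close>
  have "sphere_class p g ?Q (\<lambda>s. (1/2) *\<^sub>R s) = \<one>\<^bsub>homology_group p (top_of_set ?Q)\<^esub>"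
    using stretched_sphere_null[OF subspace_fibre \<phi>, of "1/2" 0 p g] norm_cvec[of 0] p
      by (simp add: sphere_class_def)
  then have ra: "?r (sphere_class p g ?Y ?a) = \<one>\<^bsub>homology_group p (top_of_set ?Q)\<^esub>" using push[OF a] by simp
  have "sphere_class p g ?Q (\<lambda>s. 3 *\<^sub>R s) \<noteq> \<one>\<^bsub>homology_group p (top_of_set ?Q)\<^esub>"
    unfolding sphere_class_def using norm_cvec[of 0] g
    by (intro sphere_around_point_nontrivial[OF subspace_fibre]) auto
  then have "?r (sphere_class p g ?Y ?b) \<noteq> \<one>\<^bsub>homology_group p (top_of_set ?Q)\<^esub>" using push[OF b] by simp
  moreover have "?r ?aa = \<one>\<^bsub>homology_group p (top_of_set ?Q)\<^esub>" using ra by simp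
  ultimately show False using eq by simp
qed

end

section \<open>Choice of coordinates and conclusion\<close>

lemma threefold_fan_exists:
  assumes "CARD('n::finite) \<ge> 4" and "2 \<le> k" and "k \<le> CARD('n) - 2"
  obtains K and a b c d :: "'n::finite" where "threefold_fan K a b c d" "card K = k"
proof -
  obtain K :: "'n set" where K: "card K = k"
  proof (rule obtain_subset_with_card_n[of k "UNIV :: 'n set"])
    show "k \<le> CARD('n)" using assms by simp
  qed
  obtain S where "S \<subseteq> K" "card S = 2" using obtain_subset_with_card_n[of 2 K] assms(2) K by metis
  then obtain a b where ab: "a \<in> K" "b \<in> K" "a \<noteq> b" by (auto simp: card_2_iff)
  have "card (- K) \<ge> 2" using assms K by (simp add: Compl_eq_Diff_UNIV card_Diff_subset)
  then obtain T where "T \<subseteq> - K" "card T = 2" using obtain_subset_with_card_n by blast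
  then obtain c d where "c \<notin> K" "d \<notin> K" "c \<noteq> d" by (auto simp: card_2_iff)
  then show thesis using that[of K a b c d] ab K by (simp add: threefold_fan_def)
qed

theorem theorem2:
  fixes k :: nat
  assumes "CARD('n::finite) \<ge> 4" and "2 \<le> k" and "k \<le> CARD('n) - 2"
  shows "\<exists>(C :: (real^'n) set set) w.
           tropical_variety k C w \<and> \<not> globally_convex (CARD('n) - k) (- \<Union>C)"
proof -
  obtain K and a b c d :: 'n where fan: "threefold_fan K a b c d" and K: "card K = k"
    using threefold_fan_exists[OF assms] .
  interpret threefold_fan K a b c d by (rule fan)
  have "tropical_variety k cells weight" using tropical_variety_cells K by simp
  moreover have "\<not> globally_convex (CARD('n) - k) (- \<Union>cells)"
    using not_globally_convex_complement K assms by simp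
  ultimately show ?thesis by blast
qed

end
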